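(* Let $A_5 \wr C_2 = (A_5 \times A_5) \rtimes \langle \varepsilon \rangle$, where $\varepsilon$ has order $2$ and acts on $A_5 \times A_5$ by exchanging the two coordinates. Then $$\sigma(A_5 \wr C_2) = 1 + 4 \cdot 5 + 6 \cdot 6 = 57.$$
   Context: For a finite non-cyclic group $X$, $\sigma(X)$ denotes the least number of proper subgroups of $X$ whose set-theoretic union is $X$. *)

theory Defs
  imports "HOL-Algebra.Algebra"
begin

definition is_subgroup_cover :: "('a, 'b) monoid_scheme \<Rightarrow> 'a set set \<Rightarrow> bool"
  where "is_subgroup_cover G C \<longleftrightarrow>
    (\<forall>H\<in>C. subgroup H G \<and> H \<noteq> carrier G) \<and> \<Union>C = carrier G"

text \<open>Meaningful only for finite non-cyclic groups, where a finite cover exists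
  (\<open>finite_subgroup_cover_exists\<close> below).\<close>

definition covering_number :: "('a, 'b) monoid_scheme \<Rightarrow> nat"
  where "covering_number G = (LEAST n. \<exists>C. finite C \<and> card C = n \<and> is_subgroup_cover G C)"

text \<open>The pair \<open>(n, h)\<close> stands for the product \<open>n h\<close>, and \<open>h n h\<^sup>-\<^sup>1 = \<phi> h n\<close>.\<close>

definition semidirect_product ::
    "('a, 'c) monoid_scheme \<Rightarrow> ('b, 'd) monoid_scheme \<Rightarrow> ('b \<Rightarrow> 'a \<Rightarrow> 'a) \<Rightarrow> ('a \<times> 'b) monoid"
  where "semidirect_product N H \<phi> =
    \<lparr>carrier = carrier N \<times> carrier H,
     monoid.mult = (\<lambda>(n, h) (n', h'). (n \<otimes>\<^bsub>N\<^esub> \<phi> h n', h \<otimes>\<^bsub>H\<^esub> h')),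
     one = (\<one>\<^bsub>N\<^esub>, \<one>\<^bsub>H\<^esub>)\<rparr>"

text \<open>The group \<open>\<langle>\<epsilon>\<rangle>\<close> of order 2 is the additive group \<open>{0, 1}\<close> of integers modulo 2, with
  \<open>\<epsilon> = 1\<close>.\<close>

definition wreath_C2 :: "('a, 'b) monoid_scheme \<Rightarrow> (('a \<times> 'a) \<times> int) monoid"
  where "wreath_C2 G = semidirect_product (G \<times>\<times> G) (integer_mod_group 2)
    (\<lambda>k. if k = 0 then id else prod.swap)"

lemma finite_subgroup_cover_exists:
  fixes G (structure)
  assumes "group G" "finite (carrier G)" "\<not> cyclic_group G"
  shows "\<exists>C. finite C \<and> is_subgroup_cover G C"
proof -
  interpret group G by fact
  let ?C = "(\<lambda>x. generate G {x}) ` carrier G"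
  have "generate G {x} \<noteq> carrier G" if "x \<in> carrier G" for x
  proof
    assume "generate G {x} = carrier G"
    then have "carrier G = range (\<lambda>n::int. x [^] n)"
      using generate_pow[OF that] by (simp add: full_SetCompr_eq)
    then show False
      using assms(3) that cyclic_group by blast
  qed
  moreover have "subgroup (generate G {x}) G" if "x \<in> carrier G" for x
    using that by (simp add: generate_is_subgroup)
  moreover have "\<Union>?C = carrier G"
    using generate.incl[of _ "{_}" G] generate_in_carrier[of "{_}"] by fastforce
  ultimately show ?thesis
    using assms(2) unfolding is_subgroup_cover_def by (intro exI[of _ ?C]) auto
qed

lemma carrier_wreath_C2:
  "carrier (wreath_C2 G) = (carrier G \<times> carrier G) \<times> {0, 1}"
  by (auto simp: wreath_C2_def semidirect_product_def DirProd_def integer_mod_group_def)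

lemma mult_wreath_C2:
  "((a, b), k) \<otimes>\<^bsub>wreath_C2 G\<^esub> ((c, d), l) =
    (if k = 0 then (a \<otimes>\<^bsub>G\<^esub> c, b \<otimes>\<^bsub>G\<^esub> d) else (a \<otimes>\<^bsub>G\<^esub> d, b \<otimes>\<^bsub>G\<^esub> c), (k + l) mod 2)"
  by (simp add: wreath_C2_def semidirect_product_def DirProd_def integer_mod_group_def)

lemma one_wreath_C2: "\<one>\<^bsub>wreath_C2 G\<^esub> = ((\<one>\<^bsub>G\<^esub>, \<one>\<^bsub>G\<^esub>), 0)"
  by (simp add: wreath_C2_def semidirect_product_def DirProd_def)

lemma group_wreath_C2:
  fixes G (structure)
  assumes "group G"
  shows "group (wreath_C2 G)"
proof -
  interpret group G by fact
  show ?thesis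
  proof (rule groupI)
    fix x y assume "x \<in> carrier (wreath_C2 G)" "y \<in> carrier (wreath_C2 G)"
    then show "x \<otimes>\<^bsub>wreath_C2 G\<^esub> y \<in> carrier (wreath_C2 G)"
      by (auto simp: carrier_wreath_C2 mult_wreath_C2)
  next
    show "\<one>\<^bsub>wreath_C2 G\<^esub> \<in> carrier (wreath_C2 G)"
      by (simp add: carrier_wreath_C2 one_wreath_C2)
  next
    fix x y z
    assume "x \<in> carrier (wreath_C2 G)" "y \<in> carrier (wreath_C2 G)" "z \<in> carrier (wreath_C2 G)"
    then show "x \<otimes>\<^bsub>wreath_C2 G\<^esub> y \<otimes>\<^bsub>wreath_C2 G\<^esub> z
        = x \<otimes>\<^bsub>wreath_C2 G\<^esub> (y \<otimes>\<^bsub>wreath_C2 G\<^esub> z)"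
      by (auto simp: carrier_wreath_C2 mult_wreath_C2 m_assoc)
  next
    fix x assume "x \<in> carrier (wreath_C2 G)"
    then show "\<one>\<^bsub>wreath_C2 G\<^esub> \<otimes>\<^bsub>wreath_C2 G\<^esub> x = x"
      by (auto simp: carrier_wreath_C2 mult_wreath_C2 one_wreath_C2)
  next
    fix x assume x: "x \<in> carrier (wreath_C2 G)"
    obtain a b k where x_eq: "x = ((a, b), k)" by (metis prod.exhaust)
    let ?y = "(if k = 0 then (inv a, inv b) else (inv b, inv a), k)"
    have "?y \<otimes>\<^bsub>wreath_C2 G\<^esub> x = \<one>\<^bsub>wreath_C2 G\<^esub>" "?y \<in> carrier (wreath_C2 G)"
      using x by (auto simp: x_eq carrier_wreath_C2 mult_wreath_C2 one_wreath_C2)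
    then show "\<exists>y\<in>carrier (wreath_C2 G). y \<otimes>\<^bsub>wreath_C2 G\<^esub> x = \<one>\<^bsub>wreath_C2 G\<^esub>"
      by blast
  qed
qed

lemma finite_wreath_C2:
  "finite (carrier G) \<Longrightarrow> finite (carrier (wreath_C2 G))"
  by (simp add: carrier_wreath_C2)

lemma not_cyclic_wreath_C2:
  fixes G (structure)
  assumes "group G" "\<not> trivial_group G"
  shows "\<not> cyclic_group (wreath_C2 G)"
proof
  interpret group G by fact
  assume "cyclic_group (wreath_C2 G)"
  then have comm: "comm_group (wreath_C2 G)"
    by (rule group.cyclic_imp_abelian_group[OF group_wreath_C2[OF assms(1)]])
  have "carrier G \<subseteq> {\<one>}"
  proof
    fix a assume a: "a \<in> carrier G"
    have "((a, \<one>), 0) \<otimes>\<^bsub>wreath_C2 G\<^esub> ((\<one>, \<one>), 1)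
        = ((\<one>, \<one>), 1) \<otimes>\<^bsub>wreath_C2 G\<^esub> ((a, \<one>), 0)" (is "?l = ?r")
      by (rule comm_monoid.m_comm[OF comm_group.axioms(1)[OF comm]])
        (simp_all add: carrier_wreath_C2 a)
    then have "fst (fst ?l) = fst (fst ?r)" by (rule arg_cong)
    then show "a \<in> {\<one>}"
      using a by (simp add: mult_wreath_C2)
  qed
  then show False
    using assms(2) trivial_group_subset by metis
qed

lemma wreath_C2_alt_group_5:
  "group (wreath_C2 (alt_group 5))" "finite (carrier (wreath_C2 (alt_group 5)))"
  "\<not> cyclic_group (wreath_C2 (alt_group 5))"
proof -
  have G: "group (alt_group 5)" by (rule alt_group_is_group)
  have card: "2 * card (carrier (alt_group 5)) = fact 5"
    by (rule alt_group_card_carrier) simp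
  have fin: "finite (carrier (alt_group 5))"
  proof (rule ccontr)
    assume "infinite (carrier (alt_group 5))"
    with card show False by simp
  qed
  have nontriv: "\<not> trivial_group (alt_group 5)"
  proof
    assume "trivial_group (alt_group 5)"
    then have "carrier (alt_group 5) = {\<one>\<^bsub>alt_group 5\<^esub>}" by (simp add: trivial_group_def)
    then have "card (carrier (alt_group 5)) = 1" by simp
    with card show False by (simp add: fact_numeral)
  qed
  show "group (wreath_C2 (alt_group 5))" by (rule group_wreath_C2[OF G])
  show "finite (carrier (wreath_C2 (alt_group 5)))" by (rule finite_wreath_C2[OF fin])
  show "\<not> cyclic_group (wreath_C2 (alt_group 5))" by (rule not_cyclic_wreath_C2[OF G nontriv])
qed

end

theory Submission
  imports Defs
begin

text \<open>
  Let \<open>N\<close> be the base group. Consider the elements \<open>(t s\<^sup>-\<^sup>1, s t) \<epsilon>\<close> outside \<open>N\<close>, where \<open>t\<close> has odd order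
  and hence \<open>s\<close> and \<open>t\<close> are determined by the element. For a subgroup \<open>H\<close> and fixed \<open>s\<close>, the set
  \<open>K\<^sub>s = {t. (t s\<^sup>-\<^sup>1, s t) \<epsilon> \<in> H}\<close> has no element of odd order except when \<open>(s\<^sup>-\<^sup>1, s) \<epsilon> \<in> H\<close>, and then it is a
  subgroup of \<open>A\<^sub>5\<close>. In that case charge \<open>H\<close> at \<open>s\<close> with 56 if \<open>K\<^sub>s = A\<^sub>5\<close>, with 6 if \<open>K\<^sub>s\<close> is proper and
  contains an element of order 5, and with 5 if it is proper and contains an element of order 3
  (both together generate \<open>A\<^sub>5\<close>).

  Covering the elements of order 5 of \<open>A\<^sub>5\<close> by proper subgroups takes six of them, and covering those
  of order 3 takes four, so in a cover the charges at each of the 60 values of \<open>s\<close> add up to at least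
  \<open>6 \<cdot> 6 + 4 \<cdot> 5 = 56\<close>. Conversely a proper subgroup collects at most 60 in total: either its
  projection to a factor is proper, of order at most 10 or 12, and bounds the number of relevant \<open>s\<close>;
  or \<open>H \<inter> N\<close> is the graph of an automorphism, and each \<open>t\<close> of odd order lies in at most one \<open>K\<^sub>s\<close>.
  So at least 56 members of a cover are charged. One more, containing a pair of elements of orders
  5 and 3, is not.

  For the upper bound, take \<open>N\<close>, the stabilizers of \<open>(i, j)\<close> with \<open>i \<le> 4\<close> and \<open>j \<le> 5\<close>, and the
  stabilizers of pairs of Sylow 5-subgroups: an element of \<open>A\<^sub>5\<close> either normalizes a Sylow 5-subgroup
  or is a 3-cycle, which has two fixed points.
\<close>

section \<open>A computable copy of the alternating group\<close>

text \<open>A tuple of images represents an arbitrary self-map of five points, and constructors let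
  the simplifier evaluate every operation. Bijectivity enters only through
  \<open>even5\<close>.\<close>

datatype point = P1 | P2 | P3 | P4 | P5
datatype perm5 = Perm point point point point point

fun app5 :: "perm5 \<Rightarrow> point \<Rightarrow> point" where
  "app5 (Perm a b c d e) P1 = a"
| "app5 (Perm a b c d e) P2 = b"
| "app5 (Perm a b c d e) P3 = c"
| "app5 (Perm a b c d e) P4 = d"
| "app5 (Perm a b c d e) P5 = e"

fun comp5 :: "perm5 \<Rightarrow> perm5 \<Rightarrow> perm5" where
  "comp5 p (Perm a b c d e) = Perm (app5 p a) (app5 p b) (app5 p c) (app5 p d) (app5 p e)"

definition id5 :: perm5 where
  "id5 = Perm P1 P2 P3 P4 P5"

text \<open>The final \<open>P5\<close> is what remains once the other four points are excluded,
  hence the correct value for a permutation; \<open>inv5\<close> is only applied to those.\<close>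

definition preim5 :: "perm5 \<Rightarrow> point \<Rightarrow> point" where
  "preim5 p y = (if app5 p P1 = y then P1 else if app5 p P2 = y then P2
     else if app5 p P3 = y then P3 else if app5 p P4 = y then P4 else P5)"

definition inv5 :: "perm5 \<Rightarrow> perm5" where
  "inv5 p = Perm (preim5 p P1) (preim5 p P2) (preim5 p P3) (preim5 p P4) (preim5 p P5)"

fun below5 :: "point \<Rightarrow> point \<Rightarrow> bool" where
  "below5 P1 P1 = False"
| "below5 P1 P2 = True"
| "below5 P1 P3 = True"
| "below5 P1 P4 = True"
| "below5 P1 P5 = True"
| "below5 P2 P1 = False"
| "below5 P2 P2 = False"
| "below5 P2 P3 = True"
| "below5 P2 P4 = True"
| "below5 P2 P5 = True"
| "below5 P3 P1 = False"
| "below5 P3 P2 = False"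
| "below5 P3 P3 = False"
| "below5 P3 P4 = True"
| "below5 P3 P5 = True"
| "below5 P4 P1 = False"
| "below5 P4 P2 = False"
| "below5 P4 P3 = False"
| "below5 P4 P4 = False"
| "below5 P4 P5 = True"
| "below5 P5 P1 = False"
| "below5 P5 P2 = False"
| "below5 P5 P3 = False"
| "below5 P5 P4 = False"
| "below5 P5 P5 = False"

text \<open>A chain of equalities between truth values is true iff an even number of them is false.\<close>

fun even5 :: "perm5 \<Rightarrow> bool" where
  "even5 (Perm a b c d e) \<longleftrightarrow>
    (if a = b \<or> a = c \<or> a = d \<or> a = e \<or> b = c \<or> b = d \<or> b = e \<or> c = d \<or> c = e \<or> d = e then False
     else below5 a b = (below5 a c = (below5 a d = (below5 a e = (below5 b c =
       (below5 b d = (below5 b e = (below5 c d = (below5 c e = below5 d e)))))))))"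

definition alt5 :: "perm5 list" where
  "alt5 = [
    Perm P1 P2 P3 P4 P5, Perm P1 P2 P4 P5 P3, Perm P1 P2 P5 P3 P4, Perm P1 P3 P2 P5 P4,
    Perm P1 P3 P4 P2 P5, Perm P1 P3 P5 P4 P2, Perm P1 P4 P2 P3 P5, Perm P1 P4 P3 P5 P2,
    Perm P1 P4 P5 P2 P3, Perm P1 P5 P2 P4 P3, Perm P1 P5 P3 P2 P4, Perm P1 P5 P4 P3 P2,
    Perm P2 P1 P3 P5 P4, Perm P2 P1 P4 P3 P5, Perm P2 P1 P5 P4 P3, Perm P2 P3 P1 P4 P5,
    Perm P2 P3 P4 P5 P1, Perm P2 P3 P5 P1 P4, Perm P2 P4 P1 P5 P3, Perm P2 P4 P3 P1 P5,
    Perm P2 P4 P5 P3 P1, Perm P2 P5 P1 P3 P4, Perm P2 P5 P3 P4 P1, Perm P2 P5 P4 P1 P3,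
    Perm P3 P1 P2 P4 P5, Perm P3 P1 P4 P5 P2, Perm P3 P1 P5 P2 P4, Perm P3 P2 P1 P5 P4,
    Perm P3 P2 P4 P1 P5, Perm P3 P2 P5 P4 P1, Perm P3 P4 P1 P2 P5, Perm P3 P4 P2 P5 P1,
    Perm P3 P4 P5 P1 P2, Perm P3 P5 P1 P4 P2, Perm P3 P5 P2 P1 P4, Perm P3 P5 P4 P2 P1,
    Perm P4 P1 P2 P5 P3, Perm P4 P1 P3 P2 P5, Perm P4 P1 P5 P3 P2, Perm P4 P2 P1 P3 P5,
    Perm P4 P2 P3 P5 P1, Perm P4 P2 P5 P1 P3, Perm P4 P3 P1 P5 P2, Perm P4 P3 P2 P1 P5,
    Perm P4 P3 P5 P2 P1, Perm P4 P5 P1 P2 P3, Perm P4 P5 P2 P3 P1, Perm P4 P5 P3 P1 P2,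
    Perm P5 P1 P2 P3 P4, Perm P5 P1 P3 P4 P2, Perm P5 P1 P4 P2 P3, Perm P5 P2 P1 P4 P3,
    Perm P5 P2 P3 P1 P4, Perm P5 P2 P4 P3 P1, Perm P5 P3 P1 P2 P4, Perm P5 P3 P2 P4 P1,
    Perm P5 P3 P4 P1 P2, Perm P5 P4 P1 P3 P2, Perm P5 P4 P2 P1 P3, Perm P5 P4 P3 P2 P1]"

lemma app5_comp5: "app5 (comp5 p q) x = app5 p (app5 q x)"
  by (cases q; cases x) simp_all

lemma comp5_assoc: "comp5 (comp5 p q) r = comp5 p (comp5 q r)"
  by (cases r) (simp add: app5_comp5)

lemma app5_id5: "app5 id5 x = x"
  by (cases x) (simp_all add: id5_def)

lemma comp5_id5: "comp5 id5 p = p" "comp5 p id5 = p"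
  by (cases p; simp add: app5_id5) (cases p; simp add: id5_def)

fun forall_in :: "'a list \<Rightarrow> ('a \<Rightarrow> bool) \<Rightarrow> bool" where
  "forall_in [] P \<longleftrightarrow> True"
| "forall_in (x # xs) P \<longleftrightarrow> (if P x then forall_in xs P else False)"

lemma forall_in_iff: "forall_in xs P \<longleftrightarrow> (\<forall>x\<in>set xs. P x)"
  by (induction xs) auto

text \<open>As congruence rules, this one and its analogue for \<open>forall_alt5\<close> keep the simplifier from expanding
  inner quantifiers before the outer variables are instantiated.\<close>

lemma forall_in_weak_cong: "forall_in xs P = forall_in xs P"
  ..

lemma forall_point: "(\<forall>i. P i) \<longleftrightarrow> forall_in [P1, P2, P3, P4, P5] P"
  unfolding forall_in_iff by (auto intro: point.induct)

definition forall_alt5 :: "(perm5 \<Rightarrow> bool) \<Rightarrow> bool" where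
  "forall_alt5 P \<longleftrightarrow> forall_in alt5 P"

lemma ball_alt5: "(\<forall>p\<in>set alt5. P p) \<longleftrightarrow> forall_alt5 P"
  by (simp add: forall_alt5_def forall_in_iff)

lemma forall_alt5_weak_cong: "forall_alt5 P = forall_alt5 P"
  ..

text \<open>Under \<open>if_weak_cong\<close> a condition is decided before the branches are
  touched, so connectives written as \<open>if\<close> short-circuit and prune the
  enumeration.\<close>

lemma imp_if: "(P \<longrightarrow> Q) = (if P then Q else True)" by simp
lemma conj_if: "(P \<and> Q) = (if P then Q else False)" by simp
lemma disj_if: "(P \<or> Q) = (if P then True else Q)" by simp

lemmas compute5 = app5.simps comp5.simps id5_def inv5_def preim5_def below5.simps even5.simps
  forall_alt5_def[unfolded alt5_def] forall_in.simps point.simps perm5.simps simp_thms if_True if_False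
lemmas cong5 = forall_alt5_weak_cong forall_in_weak_cong if_weak_cong

lemma even5_in_alt5: "even5 p \<Longrightarrow> p \<in> set alt5"
proof -
  have "\<forall>a b c d e. even5 (Perm a b c d e) \<longrightarrow> Perm a b c d e \<in> set alt5"
    unfolding forall_point imp_if
    by (simp only: compute5 alt5_def list.set insert_iff cong: cong5)
  then show "even5 p \<Longrightarrow> p \<in> set alt5"
    by (cases p) simp
qed

lemma even5_alt5: "\<forall>p\<in>set alt5. even5 p"
  unfolding ball_alt5 by (simp only: compute5 cong: cong5)

lemma set_alt5: "set alt5 = {p. even5 p}"
  using even5_in_alt5 even5_alt5 by blast

lemma distinct_alt5: "distinct alt5"
  by (simp only: alt5_def compute5 distinct.simps list.set insert_iff empty_iff)

lemma comp5_closed: "\<forall>p\<in>set alt5. \<forall>q\<in>set alt5. comp5 p q \<in> set alt5"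
proof -
  have "\<forall>p\<in>set alt5. \<forall>q\<in>set alt5. even5 (comp5 p q)"
    unfolding ball_alt5 by (simp only: compute5 cong: cong5)
  then show ?thesis by (simp add: set_alt5)
qed

lemma inv5_closed: "\<forall>p\<in>set alt5. inv5 p \<in> set alt5"
proof -
  have "\<forall>p\<in>set alt5. even5 (inv5 p)"
    unfolding ball_alt5 by (simp only: compute5 cong: cong5)
  then show ?thesis by (simp add: set_alt5)
qed

lemma comp5_inv5: "\<forall>p\<in>set alt5. comp5 (inv5 p) p = id5 \<and> comp5 p (inv5 p) = id5"
  unfolding ball_alt5 by (simp only: compute5 cong: cong5)

lemma id5_closed: "id5 \<in> set alt5"
  by (simp add: set_alt5 id5_def)

text \<open>With this type, transfer turns unrestricted quantifiers into ones bounded by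
  \<open>set alt5\<close>, which can be enumerated.\<close>

typedef a5 = "set alt5"
  using id5_closed by blast

setup_lifting type_definition_a5

instantiation a5 :: "{monoid_mult, inverse}"
begin
lift_definition one_a5 :: a5 is id5
  by (rule id5_closed)
lift_definition times_a5 :: "a5 \<Rightarrow> a5 \<Rightarrow> a5" is comp5
  using comp5_closed by blast
lift_definition inverse_a5 :: "a5 \<Rightarrow> a5" is inv5
  using inv5_closed by blast
definition divide_a5 :: "a5 \<Rightarrow> a5 \<Rightarrow> a5" where
  "divide_a5 x y = x * inverse y"
instance
  by standard (transfer, simp add: comp5_assoc comp5_id5)+
end

lift_definition act :: "a5 \<Rightarrow> point \<Rightarrow> point" is app5 .

lemma act_mult: "act (x * y) i = act x (act y i)" by transfer (rule app5_comp5)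
lemma act_one: "act 1 i = i" by transfer (rule app5_id5)

lemma a5_left_inverse [simp]: "inverse x * x = (1::a5)"
  by transfer (use comp5_inv5 in blast)
lemma a5_right_inverse [simp]: "x * inverse x = (1::a5)"
  by transfer (use comp5_inv5 in blast)
lemma a5_cancel [simp]: "inverse x * (x * y) = (y::a5)" "x * (inverse x * y) = (y::a5)"
  by (simp_all flip: mult.assoc)
lemma a5_mult_left_cancel [simp]: "x * y = x * z \<longleftrightarrow> y = (z::a5)"
  by (metis a5_cancel(1))
lemma a5_mult_right_cancel [simp]: "y * x = z * x \<longleftrightarrow> y = (z::a5)"
  by (metis a5_right_inverse mult.assoc mult.right_neutral)
lemma a5_inverse_unique: "x * y = (1::a5) \<Longrightarrow> inverse x = y"
  by (metis a5_cancel(1) mult.right_neutral)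
lemma a5_inverse_inverse [simp]: "inverse (inverse x) = (x::a5)"
  by (rule a5_inverse_unique) simp
lemma a5_inverse_one [simp]: "inverse 1 = (1::a5)"
  by (rule a5_inverse_unique) simp
lemma a5_inverse_mult [simp]: "inverse (x * y) = inverse y * inverse (x::a5)"
  by (rule a5_inverse_unique) (simp add: mult.assoc)

lemma a5_conj_eq_iff: "x * (c * inverse x) = d \<longleftrightarrow> x * c = d * (x :: a5)"
  by (metis a5_left_inverse a5_mult_right_cancel mult.assoc mult.right_neutral)

lift_definition order3 :: "a5 \<Rightarrow> bool" is
  "\<lambda>t. t \<noteq> id5 \<and> comp5 t (comp5 t t) = id5" .

lift_definition order5 :: "a5 \<Rightarrow> bool" is
  "\<lambda>t. t \<noteq> id5 \<and> comp5 t (comp5 t (comp5 t (comp5 t t))) = id5" .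

text \<open>In \<open>A\<^sub>5\<close> an element \<open>c\<close> of order 5 is never conjugate to \<open>c\<^sup>2\<close> or \<open>c\<^sup>3\<close>.\<close>

lift_definition normalizes5 :: "a5 \<Rightarrow> a5 \<Rightarrow> bool" is
  "\<lambda>x c. comp5 x c = comp5 c x \<or> comp5 x c = comp5 c (comp5 c (comp5 c (comp5 c x)))" .

lemma order3_iff: "order3 t \<longleftrightarrow> t \<noteq> 1 \<and> t * (t * t) = 1"
  by transfer simp

lemma order5_iff: "order5 t \<longleftrightarrow> t \<noteq> 1 \<and> t * (t * (t * (t * t))) = 1"
  by transfer simp

lemma normalizes5_iff: "normalizes5 x c \<longleftrightarrow> x * c = c * x \<or> x * c = c * (c * (c * (c * x)))"
  by transfer simp

section \<open>Finite facts about the alternating group, verified by enumeration\<close>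

lemma bex_alt5: "(\<exists>p\<in>set alt5. P p) \<longleftrightarrow> \<not> forall_alt5 (\<lambda>p. \<not> P p)"
  by (simp flip: ball_alt5)

lemma ex_point: "(\<exists>i. P i) \<longleftrightarrow> \<not> forall_in [P1, P2, P3, P4, P5] (\<lambda>i. \<not> P i)"
  unfolding forall_point[symmetric] by blast

lemmas expand5 = Collect_mem_eq ball_alt5 bex_alt5 forall_point ex_point imp_if conj_if disj_if
  insert_iff empty_iff

text \<open>The normalizer of a Sylow 5-subgroup is dihedral of order 10, and 3 does not divide
  10.\<close>

lemma order3_not_normalizes5:
  "\<forall>c. order5 c \<longrightarrow> (\<forall>t. order3 t \<longrightarrow> \<not> normalizes5 t c)"
  by (transfer, unfold expand5) (simp only: compute5 cong: cong5)

lemma order5_normalizes5: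
  "\<forall>c. order5 c \<longrightarrow> (\<forall>x. order5 x \<longrightarrow> normalizes5 x c \<longrightarrow>
    x \<in> {c, c * c, c * (c * c), c * (c * (c * c))})"
  by (transfer, unfold expand5) (simp only: compute5 cong: cong5)

text \<open>The witness \<open>y\<close> is a reflection in the dihedral normalizer, whose ten
  elements form two cosets of the powers of \<open>c\<close>.\<close>

lemma normalizer5:
  "\<forall>c. order5 c \<longrightarrow> (\<exists>y. \<forall>x. normalizes5 x c \<longrightarrow>
    x \<in> {1, c, c * c, c * (c * c), c * (c * (c * c)),
      y, c * y, c * (c * y), c * (c * (c * y)), c * (c * (c * (c * y)))})"
  by (transfer, unfold expand5) (simp only: compute5 cong: cong5)

text \<open>This carries the simplicity of the group: a normal subgroup containing \<open>x\<close>
  contains these products, hence elements of orders 3 and 5.\<close>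

lemma ex_conj_product_odd_order:
  "\<forall>x. x \<noteq> 1 \<longrightarrow> (\<exists>g. order3 (x * (g * (x * inverse g)))) \<and> (\<exists>g. order5 (x * (g * (x * inverse g))))"
  by (transfer, unfold expand5) (simp only: compute5 cong: cong5)

text \<open>Three 3-cycles without a common fixed point generate the whole group, and an element of
  order 5 already occurs among these short words.\<close>

lemma order3_triple:
  "\<forall>t. order3 t \<longrightarrow> (\<forall>u. order3 u \<longrightarrow> (\<forall>v. order3 v \<longrightarrow>
    (\<exists>i. act t i = i \<and> act u i = i \<and> act v i = i) \<or>
    order5 (t * u) \<or> order5 (t * v) \<or> order5 (u * v) \<or> order5 (t * (t * u)) \<or>
    order5 (t * (t * v)) \<or> order5 (u * (u * v)) \<or> order5 (t * (u * v)) \<or>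
    order5 (t * (t * (u * v))) \<or> order5 (t * (u * (u * v))) \<or> order5 (t * (u * (v * v)))))"
  by (transfer, unfold expand5) (simp only: compute5 cong: cong5)

text \<open>Take a 3-cycle on three points that include \<open>i\<close>, \<open>j\<close> and
  \<open>k\<close>. Thus three point stabilizers never cover the elements of order 3.\<close>

lemma ex_order3_moving:
  "\<forall>i j k. \<exists>t. order3 t \<and> act t i \<noteq> i \<and> act t j \<noteq> j \<and> act t k \<noteq> k"
  by (transfer, unfold expand5) (simp only: compute5 cong: cong5)

lemma normalizes5_or_fixes_point:
  "\<forall>x. (\<exists>c. order5 c \<and> normalizes5 x c) \<or> (\<exists>i. i \<noteq> P5 \<and> act x i = i)"
  by (transfer, unfold expand5) (simp only: compute5 cong: cong5)

text \<open>The condition \<open>act c P1 = P2\<close> selects one generator of each Sylow 5-subgroup.\<close>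

lemma sylow5_representative_unique:
  "\<forall>c. order5 c \<longrightarrow> act c P1 = P2 \<longrightarrow>
    act (c * c) P1 \<noteq> P2 \<and> act (c * (c * c)) P1 \<noteq> P2 \<and> act (c * (c * (c * c))) P1 \<noteq> P2"
  by (transfer, unfold expand5) (simp only: compute5 cong: cong5)

abbreviation double_coset5_words :: "a5 \<Rightarrow> a5 \<Rightarrow> a5 list" where
  "double_coset5_words c x \<equiv>
    [1, c, c * c, c * (c * c), c * (c * (c * c)),
     x, x * c, x * (c * c), x * (c * (c * c)), x * (c * (c * (c * c))),
     c * x, c * (x * c), c * (x * (c * c)), c * (x * (c * (c * c))), c * (x * (c * (c * (c * c)))),
     c * (c * x), c * (c * (x * c)), c * (c * (x * (c * c))),
     c * (c * (x * (c * (c * c)))), c * (c * (x * (c * (c * (c * c))))),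
     c * (c * (c * x)), c * (c * (c * (x * c))), c * (c * (c * (x * (c * c)))),
     c * (c * (c * (x * (c * (c * c))))), c * (c * (c * (x * (c * (c * (c * c)))))),
     c * (c * (c * (c * x))), c * (c * (c * (c * (x * c)))), c * (c * (c * (c * (x * (c * c))))),
     c * (c * (c * (c * (x * (c * (c * c)))))), c * (c * (c * (c * (x * (c * (c * (c * c)))))))]"

text \<open>The 30 words enumerate \<open>\<langle>c\<rangle> \<union> \<langle>c\<rangle> x \<langle>c\<rangle>\<close>; one more element of \<open>\<langle>c, x\<rangle>\<close> exceeds half of the
  group order. Fixing \<open>c\<close> up to powers by \<open>act c P1 = P2\<close> only speeds up the computation.\<close>

lemma double_coset5:
  "\<forall>c. order5 c \<longrightarrow> act c P1 = P2 \<longrightarrow> (\<forall>x. \<not> normalizes5 x c \<longrightarrow>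
    distinct (double_coset5_words c x) \<and>
    (\<exists>w\<in>{x * x, x * (c * x), x * (c * (c * x)), x * (c * (c * (c * x))), x * (c * (c * (c * (c * x))))}.
      w \<notin> set (double_coset5_words c x)))"
  by (transfer, unfold expand5)
    (simp only: compute5 conj_if disj_if distinct.simps list.set insert_iff empty_iff bex_simps
      cong: cong5)

text \<open>The powers of \<open>c\<close> act transitively on the points, so one of them sends
  \<open>P1\<close> to \<open>P2\<close>.\<close>

lemma sylow5_representative:
  "\<forall>c. order5 c \<longrightarrow> (\<exists>d. order5 d \<and> act d P1 = P2 \<and>
    d \<in> {c, c * c, c * (c * c), c * (c * (c * c))} \<and> (\<forall>x. normalizes5 x d \<longrightarrow> normalizes5 x c))"
  by (transfer, unfold expand5) (simp only: compute5 cong: cong5)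

lemma powers5_quotient:
  "\<forall>c. order5 c \<longrightarrow> (\<forall>b\<in>{1, c, c * c, c * (c * c), c * (c * (c * c))}.
     \<forall>d\<in>{1, c, c * c, c * (c * c), c * (c * (c * c))}. b = d \<or> order5 (b * inverse d))"
  by (transfer, unfold expand5 ball_simps) (simp only: compute5 cong: cong5)

lemma powers5_distinct:
  "\<forall>c. order5 c \<longrightarrow> distinct [1, c, c * c, c * (c * c), c * (c * (c * c))]"
  by (transfer, unfold expand5) (simp only: compute5 distinct.simps list.set insert_iff empty_iff disj_if cong: cong5)

lemma order3_fixed_points:
  "\<forall>t. order3 t \<longrightarrow> (\<exists>i j. act t i = i \<and> act t j = j \<and> (\<forall>k. act t k = k \<longrightarrow> k = i \<or> k = j))"
  by (transfer, unfold expand5) (simp only: compute5 cong: cong5)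

text \<open>The centralizer of \<open>t\<close> is the cyclic group generated by \<open>t\<close>,
  of odd order; one list of powers serves both orders.\<close>

lemma odd_order_centralizer:
  "\<forall>t. order3 t \<or> order5 t \<longrightarrow> (\<forall>x. x * t = t * x \<longrightarrow>
    x \<in> {1, t, t * t, t * (t * t), t * (t * (t * t))} \<and> (x * x = 1 \<longrightarrow> x = 1))"
  by (transfer, unfold expand5) (simp only: compute5 cong: cong5)

text \<open>The five alternatives say that \<open>z\<close> is the conjugate of \<open>y\<close> by
  \<open>1\<close>, \<open>c\<close>, \<open>c^2\<close>, \<open>c^-1\<close> or
  \<open>c^-2\<close>. So an automorphism fixing \<open>c\<close> moves \<open>y\<close> only within
  this orbit.\<close>

lemma involution_unique_up_to_conj:
  "\<forall>c. order5 c \<longrightarrow> (\<exists>y. y \<noteq> 1 \<and> y * y = 1 \<and> order3 (c * y) \<and>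
     y * (c * c) \<noteq> c * (c * y) \<and> y * (c * (c * (c * c))) \<noteq> c * (c * (c * (c * y))) \<and>
     (\<forall>z. z \<noteq> 1 \<longrightarrow> z * z = 1 \<longrightarrow> order3 (c * z) \<longrightarrow>
       y = z \<or> z * c = c * y \<or> z * (c * c) = c * (c * y) \<or> y * c = c * z \<or> y * (c * c) = c * (c * z)))"
  by (transfer, unfold expand5) (simp only: compute5 cong: cong5)

lemma ex_conj_not_power5:
  "\<forall>c. order5 c \<longrightarrow> (\<exists>x. x * c \<notin> {c * x, c * (c * x), c * (c * (c * x)), c * (c * (c * (c * x)))})"
  by (transfer, unfold expand5) (simp only: compute5 cong: cong5)

lemma product_of_squares: "\<forall>x :: a5. \<exists>y z. x = y * (y * (z * z))"
  by (transfer, unfold expand5) (simp only: compute5 cong: cong5)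

lemma card_a5: "card {x. P (Rep_a5 x)} = length (filter P alt5)"
proof -
  have "bij_betw Rep_a5 {x. P (Rep_a5 x)} (set (filter P alt5))"
  proof (rule bij_betw_imageI)
    show "inj_on Rep_a5 {x. P (Rep_a5 x)}"
      by (simp add: inj_on_def Rep_a5_inject)
    show "Rep_a5 ` {x. P (Rep_a5 x)} = set (filter P alt5)"
    proof (intro subset_antisym subsetI)
      fix p assume "p \<in> set (filter P alt5)"
      then have "p = Rep_a5 (Abs_a5 p)" "P p"
        by (simp_all add: Abs_a5_inverse)
      then show "p \<in> Rep_a5 ` {x. P (Rep_a5 x)}"
        by (metis (mono_tags) image_eqI mem_Collect_eq)
    qed (use Rep_a5 in auto)
  qed
  then show ?thesis
    by (metis bij_betw_same_card distinct_card distinct_filter distinct_alt5)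
qed

lemma card_UNIV_a5: "card (UNIV :: a5 set) = 60"
  using card_a5[of "\<lambda>_. True"] by (simp add: alt5_def)

lemma finite_a5 [simp]: "finite (A :: a5 set)"
  using card_UNIV_a5 by (metis card.infinite finite_subset subset_UNIV zero_neq_numeral)

lemma card_order3: "card {t. order3 t} = 20"
proof -
  have "card {t. order3 t} = length (filter (\<lambda>t. t \<noteq> id5 \<and> comp5 t (comp5 t t) = id5) alt5)"
    unfolding order3.rep_eq by (rule card_a5)
  also have "\<dots> = 20"
    by (simp only: alt5_def filter.simps compute5 conj_if cong: if_weak_cong) simp
  finally show ?thesis .
qed

lemma card_sylow5_representatives: "card {c. order5 c \<and> act c P1 = P2} = 6"
proof -
  have "card {c. order5 c \<and> act c P1 = P2} = length (filter (\<lambda>c.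
      (c \<noteq> id5 \<and> comp5 c (comp5 c (comp5 c (comp5 c c))) = id5) \<and> app5 c P1 = P2) alt5)"
    unfolding order5.rep_eq act.rep_eq by (rule card_a5)
  also have "\<dots> = 6"
    by (simp only: alt5_def filter.simps compute5 conj_if cong: if_weak_cong) simp
  finally show ?thesis .
qed

lemma ex_order5: "\<exists>c. order5 c"
proof (rule ccontr)
  assume "\<nexists>c. order5 c"
  then show False using card_sylow5_representatives by simp
qed

section \<open>Subgroups of the alternating group\<close>

definition A5 :: "a5 monoid" where
  "A5 = \<lparr>carrier = UNIV, monoid.mult = (*), one = 1\<rparr>"

lemma A5_simps [simp]: "carrier A5 = UNIV" "x \<otimes>\<^bsub>A5\<^esub> y = x * y" "\<one>\<^bsub>A5\<^esub> = 1"
  by (simp_all add: A5_def)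

interpretation A5: group A5
  by (rule groupI) (auto simp: mult.assoc intro: a5_left_inverse)

lemma inv_A5 [simp]: "inv\<^bsub>A5\<^esub> x = inverse x"
  by (rule A5.inv_equality) simp_all

lemma group_wreath_C2_A5: "group (wreath_C2 A5)"
  by (rule group_wreath_C2) (rule A5.group_axioms)

lemma inv_wreath_C2_A5:
  "inv\<^bsub>wreath_C2 A5\<^esub> ((a, b), 0) = ((inverse a, inverse b), 0)"
  "inv\<^bsub>wreath_C2 A5\<^esub> ((a, b), 1) = ((inverse b, inverse a), 1)"
  by (rule group.inv_equality[OF group_wreath_C2_A5];
      simp add: mult_wreath_C2 one_wreath_C2 carrier_wreath_C2)+

lemma subgroup_A5D:
  assumes "subgroup K A5"
  shows "1 \<in> K" "x \<in> K \<Longrightarrow> y \<in> K \<Longrightarrow> x * y \<in> K" "x \<in> K \<Longrightarrow> inverse x \<in> K"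
  using subgroup.one_closed[OF assms] subgroup.m_closed[OF assms] subgroup.m_inv_closed[OF assms]
  by auto

lemma subgroup_A5I:
  assumes "1 \<in> K" "\<And>x y. x \<in> K \<Longrightarrow> y \<in> K \<Longrightarrow> x * y \<in> K" "\<And>x. x \<in> K \<Longrightarrow> inverse x \<in> K"
  shows "subgroup K A5"
  using assms by (intro A5.subgroupI) auto

lemma subgroup_A5_eq_UNIV:
  assumes "subgroup K A5" "30 < card K"
  shows "K = UNIV"
proof -
  have "card (rcosets\<^bsub>A5\<^esub> K) * card K = 60"
    using A5.lagrange[OF assms(1)] by (simp add: order_def card_UNIV_a5)
  moreover have "card (rcosets\<^bsub>A5\<^esub> K) < 2"
  proof (rule ccontr)
    assume "\<not> ?thesis"
    then have "2 * card K \<le> card (rcosets\<^bsub>A5\<^esub> K) * card K"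
      by (intro mult_le_mono1) simp
    then show False
      using calculation assms(2) by linarith
  qed
  ultimately have "card K = 60"
    by (cases "card (rcosets\<^bsub>A5\<^esub> K)") auto
  then show ?thesis
    by (metis card_UNIV_a5 card_subset_eq finite_a5 subset_UNIV)
qed

text \<open>\<open>K\<close> contains 31 elements, more than half of 60. Passing to the power
  \<open>d\<close> of \<open>c\<close> makes \<open>double_coset5\<close> applicable.\<close>

lemma subgroup_order5_eq_UNIV:
  assumes K: "subgroup K A5" and c: "c \<in> K" "order5 c" and x: "x \<in> K" "\<not> normalizes5 x c"
  shows "K = UNIV"
proof -
  note K = subgroup_A5D[OF K] assms(1)
  obtain d where d: "order5 d" "act d P1 = P2" "d \<in> {c, c * c, c * (c * c), c * (c * (c * c))}"
    "\<not> normalizes5 x d"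
    using sylow5_representative c x by blast
  have dK: "d \<in> K"
    using d(3) c K(2) by auto
  let ?D = "double_coset5_words d x"
  obtain w where w: "w \<in> {x * x, x * (d * x), x * (d * (d * x)), x * (d * (d * (d * x))),
        x * (d * (d * (d * (d * x))))}"
      "w \<notin> set ?D" and dist: "distinct ?D"
    using double_coset5[rule_format, OF d(1,2,4)] by blast
  have "distinct (w # ?D)"
    using w(2) dist by (subst distinct.simps) blast
  then have "card (set (w # ?D)) = 31"
    by (subst distinct_card) simp_all
  moreover have "set (w # ?D) \<subseteq> K"
    using w(1) by (auto simp: K(1,2) dK x(1))
  ultimately have "31 \<le> card K"
    by (metis card_mono finite_a5)
  then show ?thesis
    using subgroup_A5_eq_UNIV assms(1) by simp
qed

lemma subgroup_order3_order5_eq_UNIV: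
  assumes "subgroup K A5" "c \<in> K" "order5 c" "t \<in> K" "order3 t"
  shows "K = UNIV"
  using subgroup_order5_eq_UNIV order3_not_normalizes5 assms by blast

lemma card_subgroup_order5:
  assumes K: "subgroup K A5" "K \<noteq> UNIV" and c: "c \<in> K" "order5 c"
  shows "card K \<le> 10"
proof -
  obtain y where "\<forall>x. normalizes5 x c \<longrightarrow>
    x \<in> {1, c, c * c, c * (c * c), c * (c * (c * c)),
      y, c * y, c * (c * y), c * (c * (c * y)), c * (c * (c * (c * y)))}"
    using normalizer5 c by blast
  then have "K \<subseteq> set [1, c, c * c, c * (c * c), c * (c * (c * c)),
      y, c * y, c * (c * y), c * (c * (c * y)), c * (c * (c * (c * y)))]" (is "_ \<subseteq> set ?L")
    using subgroup_order5_eq_UNIV[OF K(1) c] K(2) by auto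
  then have "card K \<le> card (set ?L)"
    by (intro card_mono) simp_all
  also have "\<dots> \<le> length ?L"
    by (rule card_length)
  finally show ?thesis by simp
qed

text \<open>A proper \<open>K\<close> with an element of order 3 has none of order 5, so it meets
  the group generated by any \<open>c\<close> of order 5 trivially. The products of the two are then
  distinct and 5 times \<open>card K\<close> is at most 60.\<close>

lemma card_subgroup_order3:
  assumes K: "subgroup K A5" "K \<noteq> UNIV" and t: "t \<in> K" "order3 t"
  shows "card K \<le> 12"
proof -
  obtain c where c: "order5 c"
    using ex_order5 by blast
  let ?C = "set [1, c, c * c, c * (c * c), c * (c * (c * c))]"
  have C5: "card ?C = 5"
    using powers5_distinct c by (subst distinct_card) auto
  have "inj_on (\<lambda>(k, b). k * b) (K \<times> ?C)"
  proof (rule inj_onI, clarify)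
    fix k b l d assume *: "k \<in> K" "b \<in> ?C" "l \<in> K" "d \<in> ?C" "k * b = l * d"
    then have "inverse l * k = d * inverse b"
      by (metis a5_cancel(1) a5_mult_right_cancel a5_right_inverse mult.assoc mult.right_neutral)
    then have "\<not> order5 (d * inverse b)"
      using subgroup_A5D[OF K(1)] * subgroup_order3_order5_eq_UNIV[OF K(1) _ _ t] K(2) by metis
    then have "d = b"
      using powers5_quotient c *(2,4) by (metis list.simps(15) set_empty2 list.set(1))
    with * show "k = l \<and> b = d" by simp
  qed
  then have "card (K \<times> ?C) \<le> card (UNIV :: a5 set)"
    by (rule card_inj_on_le) simp_all
  then show ?thesis
    unfolding card_cartesian_product C5 card_UNIV_a5 by simp
qed

lemma normal_subgroup_A5:
  assumes K: "subgroup K A5" and conj: "\<And>g x. x \<in> K \<Longrightarrow> g * (x * inverse g) \<in> K"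
    and x: "x \<in> K" "x \<noteq> 1"
  shows "K = UNIV"
proof -
  obtain g h where "order3 (x * (g * (x * inverse g)))" "order5 (x * (h * (x * inverse h)))"
    using ex_conj_product_odd_order x(2) by blast
  then show ?thesis
    using subgroup_order3_order5_eq_UNIV[OF K] subgroup_A5D(2)[OF K x(1) conj[OF x(1)]] by blast
qed

lemma order3_common_fixed_point:
  assumes K: "subgroup K A5" "K \<noteq> UNIV"
  shows "\<exists>i. \<forall>t\<in>K. order3 t \<longrightarrow> act t i = i"
proof (rule ccontr)
  assume none: "\<nexists>i. \<forall>t\<in>K. order3 t \<longrightarrow> act t i = i"
  then obtain t where t: "t \<in> K" "order3 t" by blast
  then have no5: "\<not> order5 c" if "c \<in> K" for c
    using subgroup_order3_order5_eq_UNIV K that by blast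
  obtain i j where ij: "\<And>k. act t k = k \<Longrightarrow> k = i \<or> k = j"
    using order3_fixed_points t by blast
  \<comment> \<open>The only possible fixed points of \<open>t\<close> are \<open>i\<close> and
    \<open>j\<close>; \<open>u\<close> moves the first and \<open>v\<close> the second.\<close>
  obtain u v where uv: "u \<in> K" "order3 u" "act u i \<noteq> i" "v \<in> K" "order3 v" "act v j \<noteq> j"
    using none by blast
  then have "\<not> (\<exists>k. act t k = k \<and> act u k = k \<and> act v k = k)"
    using ij by blast
  then show False
    using order3_triple[rule_format, OF t(2) uv(2,5)]
    by (auto simp: no5 t(1) uv(1,4) subgroup_A5D(2)[OF K(1)])
qed

section \<open>Subgroups of the wreath product\<close>

locale wreath_subgroup =
  fixes H :: "((a5 \<times> a5) \<times> int) set"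
  assumes subgroup: "subgroup H (wreath_C2 A5)"
begin

lemma mult00: "((a, b), 0) \<in> H \<Longrightarrow> ((c, d), 0) \<in> H \<Longrightarrow> ((a * c, b * d), 0) \<in> H"
  and mult01: "((a, b), 0) \<in> H \<Longrightarrow> ((c, d), 1) \<in> H \<Longrightarrow> ((a * c, b * d), 1) \<in> H"
  and mult10: "((a, b), 1) \<in> H \<Longrightarrow> ((c, d), 0) \<in> H \<Longrightarrow> ((a * d, b * c), 1) \<in> H"
  and mult11: "((a, b), 1) \<in> H \<Longrightarrow> ((c, d), 1) \<in> H \<Longrightarrow> ((a * d, b * c), 0) \<in> H"
  using subgroup.m_closed[OF subgroup] by (force simp: mult_wreath_C2)+

lemma one: "((1, 1), 0) \<in> H"
  using subgroup.one_closed[OF subgroup] by (simp add: one_wreath_C2)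

lemma inverse0: "((a, b), 0) \<in> H \<Longrightarrow> ((inverse a, inverse b), 0) \<in> H"
  and inverse1: "((a, b), 1) \<in> H \<Longrightarrow> ((inverse b, inverse a), 1) \<in> H"
  using subgroup.m_inv_closed[OF subgroup] inv_wreath_C2_A5 by metis+

lemma conj1: "((a, b), 1) \<in> H \<Longrightarrow> ((x, y), 0) \<in> H
    \<Longrightarrow> ((a * (y * inverse a), b * (x * inverse b)), 0) \<in> H"
  using mult11[OF mult10 inverse1] by (force simp: mult.assoc)

definition first_projection :: "a5 set" where
  "first_projection = {a. \<exists>b. ((a, b), 0) \<in> H}"

text \<open>The element is the product of the commuting elements \<open>((inverse s, s), 1)\<close>,
  an involution, and \<open>((t, s * t * inverse s), 0)\<close>.\<close>

definition slice :: "a5 \<Rightarrow> a5 set" where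
  "slice s = {t. ((t * inverse s, s * t), 1) \<in> H}"

text \<open>An element \<open>((a, b), 1)\<close> squares to \<open>((a * b, b * a), 0)\<close>, so
  these \<open>s\<close> parametrize the involutions of \<open>H\<close> outside the base
  group.\<close>

definition swaps :: "a5 set" where
  "swaps = {s. ((inverse s, s), 1) \<in> H}"

lemma subgroup_first_projection: "subgroup first_projection A5"
  unfolding first_projection_def
  using one mult00 inverse0 by (intro subgroup_A5I) blast+

text \<open>The third or fifth power of the element, according to the order of \<open>t\<close>,
  kills the factor from \<open>t\<close> and leaves the involution.\<close>

lemma slice_imp_swaps:
  assumes "t \<in> slice s" "order3 t \<or> order5 t"
  shows "s \<in> swaps"
proof -
  let ?g = "((t * inverse s, s * t), 1)"
  have g: "?g \<in> H"
    using assms(1) by (simp add: slice_def)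
  have gg: "((t * t, s * (t * (t * inverse s))), 0) \<in> H"
    using mult11[OF g g] by (simp add: mult.assoc)
  have "((t * (t * (t * inverse s)), s * (t * (t * t))), 1) \<in> H"
    using mult01[OF gg g] by (simp add: mult.assoc)
  moreover from mult01[OF gg this]
  have "((t * (t * (t * (t * (t * inverse s)))), s * (t * (t * (t * (t * t))))), 1) \<in> H"
    by (simp add: mult.assoc)
  moreover have "t * (t * (t * x)) = x" if "order3 t" for x
    using that by (metis mult.assoc mult_1 order3_iff)
  moreover have "t * (t * (t * (t * (t * x)))) = x" if "order5 t" for x
    using that by (metis mult.assoc mult_1 order5_iff)
  ultimately show ?thesis
    using assms(2) by (auto simp: swaps_def order3_iff order5_iff)
qed

lemma slice_iff:
  assumes "s \<in> swaps"
  shows "t \<in> slice s \<longleftrightarrow> ((t, s * (t * inverse s)), 0) \<in> H"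
proof -
  have s: "((inverse s, s), 1) \<in> H" using assms by (simp add: swaps_def)
  show ?thesis
    using mult11[OF _ s, of "t * inverse s" "s * t"] mult01[OF _ s, of t "s * (t * inverse s)"]
    by (auto simp: slice_def mult.assoc)
qed

lemma subgroup_slice:
  assumes "s \<in> swaps"
  shows "subgroup (slice s) A5"
proof (rule subgroup_A5I)
  show "1 \<in> slice s" using one by (simp add: slice_iff[OF assms])
  show "x * y \<in> slice s" if "x \<in> slice s" "y \<in> slice s" for x y
    using that mult00 by (force simp: slice_iff[OF assms] mult.assoc)
  show "inverse x \<in> slice s" if "x \<in> slice s" for x
    using that inverse0 by (force simp: slice_iff[OF assms] mult.assoc)
qed

lemma slice_subset: "s \<in> swaps \<Longrightarrow> slice s \<subseteq> first_projection"
  by (auto simp: slice_iff first_projection_def)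

text \<open>The product of two involutions of \<open>H\<close> outside the base group lies in the
  base group, so \<open>swaps\<close> lies in a single left coset of
  \<open>first_projection\<close>.\<close>

lemma card_swaps_le: "card swaps \<le> card first_projection"
proof (cases "swaps = {}")
  case False
  then obtain r where r: "r \<in> swaps" by blast
  have "swaps \<subseteq> (*) r ` first_projection"
  proof
    fix s assume "s \<in> swaps"
    with r have "((inverse r * s, r * inverse s), 0) \<in> H"
      using mult11 by (simp add: swaps_def)
    then have "inverse r * s \<in> first_projection"
      by (auto simp: first_projection_def)
    then show "s \<in> (*) r ` first_projection"
      by (rule rev_image_eqI) simp
  qed
  then show ?thesis
    by (rule surj_card_le[rotated]) simp
qed simp

text \<open>Conjugation by an element outside the base group exchanges the two coordinate kernels.
  The left kernel is nontrivial and, the projection being full, normal, so simplicity makes it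
  everything.\<close>

lemma eq_carrier:
  assumes g: "((a, b), 1) \<in> H" and P: "first_projection = UNIV"
    and x: "((x, 1), 0) \<in> H \<or> ((1, x), 0) \<in> H" "x \<noteq> 1"
  shows "H = carrier (wreath_C2 A5)"
proof -
  let ?L = "{x. ((x, 1), 0) \<in> H}"
  obtain z where z: "z \<in> ?L" "z \<noteq> 1"
  proof (cases "((x, 1), 0) \<in> H")
    case False
    then have "((a * (x * inverse a), 1), 0) \<in> H"
      using conj1[OF g, of 1 x] x(1) by simp
    moreover have "a * (x * inverse a) \<noteq> 1"
      using x(2) by (metis a5_inverse_unique a5_mult_right_cancel a5_inverse_inverse a5_right_inverse mult.assoc mult.right_neutral mult_1)
    ultimately show ?thesis using that by blast
  qed (use x that in blast)
  have "?L = UNIV"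
  proof (rule normal_subgroup_A5[OF _ _ z])
    show "subgroup ?L A5"
      using one mult00[of _ 1 _ 1] inverse0[of _ 1] by (intro subgroup_A5I) auto
    fix h y assume "y \<in> ?L"
    moreover obtain k where k: "((h, k), 0) \<in> H"
      using P by (auto simp: first_projection_def)
    ultimately have "((h * y * inverse h, k * 1 * inverse k), 0) \<in> H"
      using mult00 inverse0 by blast
    then show "h * (y * inverse h) \<in> ?L" by (simp add: mult.assoc)
  qed
  then have L: "((y, 1), 0) \<in> H" for y by blast
  have R: "((1, y), 0) \<in> H" for y
    using conj1[OF g L, of "inverse b * (y * b)"] by (simp add: mult.assoc)
  have N: "((y, z), 0) \<in> H" for y z
    using mult00[OF L R] by simp
  have "((y, z), 1) \<in> H" for y z
    using mult01[OF N g, of "y * inverse a" "z * inverse b"] by (simp add: mult.assoc)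
  with N show ?thesis
    using subgroup.subset[OF subgroup] by (auto simp: carrier_wreath_C2)
qed

end

section \<open>Bounding the total charge of a proper subgroup\<close>

lemma order3_square: "order3 t \<Longrightarrow> order3 (t * t) \<and> t * t \<noteq> t"
  unfolding order3_iff by (metis mult.assoc mult_1 mult_1_right a5_mult_left_cancel)

context wreath_subgroup
begin

definition charge :: "a5 \<Rightarrow> nat" where
  "charge s = (if s \<notin> swaps then 0 else if slice s = UNIV then 56
     else if \<exists>c\<in>slice s. order5 c then 6 else if \<exists>t\<in>slice s. order3 t then 5 else 0)"

lemma charge_pos: "0 < charge s \<Longrightarrow> s \<in> swaps \<and> (\<exists>t\<in>slice s. order3 t \<or> order5 t)"
  using ex_order5 by (auto simp: charge_def split: if_splits)

lemma sum_charge_le: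
  assumes "\<And>s. s \<in> A \<Longrightarrow> charge s \<le> m" "\<And>s. s \<notin> A \<Longrightarrow> charge s = 0" "card A * m \<le> 60"
  shows "(\<Sum>s\<in>UNIV. charge s) \<le> 60"
proof -
  have "(\<Sum>s\<in>UNIV. charge s) = (\<Sum>s\<in>A. charge s)"
    using assms(2) by (intro sum.mono_neutral_right) auto
  also have "\<dots> \<le> card A * m"
    using sum_bounded_above[of A charge m] assms(1) by simp
  finally show ?thesis using assms(3) by simp
qed

text \<open>\<open>swaps\<close> is no larger than the projection: at most 10 values charged at most
  6 if it has an element of order 5, otherwise at most 12 charged at most 5.\<close>

lemma sum_charge_le_projection_proper:
  assumes P: "first_projection \<noteq> UNIV"
  shows "(\<Sum>s\<in>UNIV. charge s) \<le> 60"
proof -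
  have proper: "slice s \<noteq> UNIV" if "s \<in> swaps" for s
    using slice_subset[OF that] P by blast
  note bounds = card_swaps_le card_subgroup_order5[OF subgroup_first_projection P]
    card_subgroup_order3[OF subgroup_first_projection P]
  have zero: "charge s = 0" if "s \<notin> swaps" for s
    using that by (simp add: charge_def)
  consider (five) c where "c \<in> first_projection" "order5 c"
    | (three) t where "t \<in> first_projection" "order3 t" "\<And>c. c \<in> first_projection \<Longrightarrow> \<not> order5 c"
    | (none) "\<And>t. t \<in> first_projection \<Longrightarrow> \<not> order3 t \<and> \<not> order5 t"
    by blast
  then show ?thesis
  proof cases
    case five
    show ?thesis
      by (rule sum_charge_le[of swaps 6])
        (use proper zero bounds(1) bounds(2)[OF five] in \<open>auto simp: charge_def\<close>)
  next
    case three
    show ?thesis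
      by (rule sum_charge_le[of swaps 5])
        (use proper zero bounds(1) bounds(3)[OF three(1,2)] slice_subset three(3) in \<open>auto simp: charge_def\<close>)
  next
    case none
    then have "charge s = 0" for s
      using charge_pos[of s] slice_subset[of s] by blast
    then show ?thesis by simp
  qed
qed

context
  fixes r
  assumes proper: "H \<noteq> carrier (wreath_C2 A5)"
    and P: "first_projection = UNIV"
    and r: "r \<in> swaps"
begin

text \<open>Otherwise \<open>eq_carrier\<close> would make \<open>H\<close> the whole group. Hence
  the intersection with the base group is the graph of an automorphism.\<close>

lemma kernel_trivial: "((x, 1), 0) \<in> H \<Longrightarrow> x = 1" "((1, x), 0) \<in> H \<Longrightarrow> x = 1"
  using eq_carrier[OF _ P, of "inverse r" r x] r proper by (auto simp: swaps_def)

lemma graph_functional: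
  assumes "((x, u), 0) \<in> H" "((x, v), 0) \<in> H"
  shows "u = v"
  using kernel_trivial(2)[of "u * inverse v"] mult00[OF assms(1) inverse0[OF assms(2)]]
  by (metis a5_inverse_inverse a5_inverse_unique a5_right_inverse a5_mult_right_cancel)

text \<open>The quotient \<open>x\<close> of \<open>s\<close> and \<open>u\<close> centralizes
  \<open>t\<close>, hence is a power of \<open>t\<close> and lies in \<open>slice s\<close>.
  Multiplying the resulting element by the involution for \<open>u\<close> gives
  \<open>((x * x, 1), 0)\<close>, so \<open>x\<close> squares to 1 and, having odd order, is
  trivial.\<close>

lemma slices_disjoint:
  assumes s: "s \<in> swaps" "t \<in> slice s" and u: "u \<in> swaps" "t \<in> slice u" and t: "order3 t \<or> order5 t"
  shows "s = u"
proof -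
  define x where "x = inverse s * u"
  have ux: "u = s * x" by (simp add: x_def)
  have "s * (t * inverse s) = u * (t * inverse u)"
    using graph_functional s u by (simp add: slice_iff)
  then have "x * t * inverse x = t"
    unfolding ux by (simp add: mult.assoc) (metis a5_mult_right_cancel mult.assoc)
  then have "x * t = t * x"
    by (metis a5_left_inverse mult.assoc mult.right_neutral)
  then have x: "x \<in> {1, t, t * t, t * (t * t), t * (t * (t * t))}" "x * x = 1 \<Longrightarrow> x = 1"
    using odd_order_centralizer t by blast+
  then have "x \<in> slice s"
    using subgroup_A5D[OF subgroup_slice[OF s(1)]] s(2) by auto
  then have "((x * inverse s, s * x), 1) \<in> H"
    by (simp add: slice_def)
  moreover have "((inverse x * inverse s, s * x), 1) \<in> H"
    using u(1) by (simp add: ux swaps_def)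
  ultimately have "((x * x, 1), 0) \<in> H"
    using mult11 by (fastforce simp: mult.assoc)
  then show ?thesis
    using kernel_trivial(1) x(2) ux by simp
qed

text \<open>\<open>slice s\<close> is the fixed subgroup of an automorphism whose square is the
  identity. If it fixes \<open>c\<close>, it also fixes an involution \<open>y\<close> with
  \<open>c * y\<close> of order 3, and then the slice has elements of both odd orders.\<close>

lemma order5_slice_eq_UNIV:
  assumes s: "s \<in> swaps" and c: "c \<in> slice s" "order5 c"
  shows "slice s = UNIV"
proof -
  note slice = subgroup_A5D[OF subgroup_slice[OF s]]
  obtain y where y: "y \<noteq> 1" "y * y = 1" "order3 (c * y)" "y * (c * c) \<noteq> c * (c * y)"
      "y * (c * (c * (c * c))) \<noteq> c * (c * (c * (c * y)))"
    and uniq: "\<And>z. z \<noteq> 1 \<Longrightarrow> z * z = 1 \<Longrightarrow> order3 (c * z) \<Longrightarrow>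
       y = z \<or> z * c = c * y \<or> z * (c * c) = c * (c * y) \<or> y * c = c * z \<or> y * (c * c) = c * (c * z)"
    using involution_unique_up_to_conj c(2) by blast
  obtain w where w: "((y, w), 0) \<in> H"
    using P by (auto simp: first_projection_def)
  \<comment> \<open>\<open>z\<close> is the image of \<open>y\<close> under this automorphism;
    \<open>zy\<close> below says that \<open>z\<close> is mapped back to \<open>y\<close>.\<close>
  define z where "z = inverse s * (w * s)"
  have yz: "((y, s * (z * inverse s)), 0) \<in> H"
    using w by (simp add: z_def mult.assoc)
  have zy: "((z, s * (y * inverse s)), 0) \<in> H"
    using conj1[OF _ w, of "inverse s" s] s by (simp add: swaps_def z_def)
  have cz: "((c * y, s * (c * (z * inverse s))), 0) \<in> H"
    using mult00[OF _ yz] c(1) s by (force simp: slice_iff mult.assoc)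
  have z1: "z \<noteq> 1"
    using yz y(1) kernel_trivial(1) by auto
  have conj_one: "s * (x * inverse s) = 1 \<longleftrightarrow> x = 1" for x
    by (metis a5_cancel(1) a5_mult_right_cancel a5_right_inverse mult.assoc mult_1 mult_1_right)
  have z2: "z * z = 1"
    using mult00[OF yz yz] y(2) kernel_trivial(2) conj_one[of "z * z"] by (simp add: mult.assoc)
  have "order3 (c * z)"
    unfolding order3_iff
  proof
    show "c * z \<noteq> 1"
    proof
      assume "c * z = 1"
      then have "((c * y, 1), 0) \<in> H"
        using cz by (metis a5_right_inverse mult.assoc mult_1)
      then show False
        using kernel_trivial(1) y(3) by (auto simp: order3_iff)
    qed
    have "((c * y * (c * y * (c * y)), s * (c * z * (c * z * (c * z))) * inverse s), 0) \<in> H"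
      using mult00[OF cz mult00[OF cz cz]] by (simp add: mult.assoc)
    then show "c * z * (c * z * (c * z)) = 1"
      using y(3) kernel_trivial(2) conj_one[of "c * z * (c * z * (c * z))"]
      by (simp add: order3_iff mult.assoc)
  qed
  note cases = uniq[OF z1 z2 this]
  \<comment> \<open>Conjugation by \<open>(s\<^sup>-\<^sup>1, s) \<epsilon>\<close> induces an involutory automorphism interchanging \<open>y\<close> and \<open>z\<close> and
    fixing \<open>\<langle>c\<rangle>\<close>. If \<open>z = q y q\<^sup>-\<^sup>1\<close> with \<open>q \<in> \<langle>c\<rangle>\<close>, applying it gives \<open>y = q z q\<^sup>-\<^sup>1\<close>, so \<open>q\<^sup>2\<close> commutes
    with \<open>y\<close>.\<close>
  have swap: "z * q = q * y \<longleftrightarrow> y * q = q * z" if "q \<in> slice s" for q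
  proof -
    have q: "((q, s * (q * inverse s)), 0) \<in> H"
      using that s by (simp add: slice_iff)
    have image: "((q * (a * inverse q), s * (q * (b * (inverse q * inverse s)))), 0) \<in> H"
      if "((a, s * (b * inverse s)), 0) \<in> H" for a b
      using mult00[OF q mult00[OF that inverse0[OF q]]] by (simp add: mult.assoc)
    have conj_eq: "a = q * (b * inverse q) \<longleftrightarrow> a * q = q * b" for a b
      using a5_conj_eq_iff by metis
    have inner: "s * (a * inverse s) = s * (q * (b * (inverse q * inverse s))) \<longleftrightarrow> a * q = q * b" for a b
      by (simp add: conj_eq[symmetric]) (metis a5_mult_right_cancel mult.assoc)
    show ?thesis
    proof
      assume *: "z * q = q * y"
      then have "q * (y * inverse q) = z" using conj_eq[of z y] by simp
      then show "y * q = q * z"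
        using graph_functional[OF zy] image[OF yz] inner by metis
    next
      assume *: "y * q = q * z"
      then have "q * (z * inverse q) = y" using conj_eq[of y z] by simp
      then show "z * q = q * y"
        using graph_functional[OF yz] image[OF zy] inner by metis
    qed
  qed
  have commute: "y * (q * q) = q * (q * y)" if "q \<in> slice s" "z * q = q * y \<or> y * q = q * z" for q
  proof -
    have "y * q = q * z" "z * q = q * y" using swap that by blast+
    then show ?thesis by (metis mult.assoc)
  qed
  have "y = z"
    using cases commute[of c] commute[of "c * c"] c(1) slice(2) y(4,5) by (auto simp: mult.assoc)
  then have "y \<in> slice s"
    using yz s by (simp add: slice_iff)
  then show ?thesis
    using subgroup_order3_order5_eq_UNIV[OF subgroup_slice[OF s] c _ y(3)] slice(2) c(1) by blast
qed

text \<open>If one slice is full, disjointness leaves no charge elsewhere. Otherwise nothing is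
  charged 6, and the 20 elements of order 3, at least two per charged slice, allow at most 10
  charges of 5.\<close>

lemma sum_charge_le_projection_full: "(\<Sum>s\<in>UNIV. charge s) \<le> 60"
proof (cases "\<exists>s\<in>swaps. slice s = UNIV")
  case True
  then obtain s where s: "s \<in> swaps" "slice s = UNIV" by blast
  have "charge u = 0" if "u \<noteq> s" for u
    using charge_pos[of u] slices_disjoint[of u _ s] s that by auto
  then show ?thesis
    by (intro sum_charge_le[of "{s}" 60]) (auto simp: charge_def)
next
  case False
  let ?I = "{s \<in> swaps. \<exists>t\<in>slice s. order3 t}"
  let ?T = "\<lambda>s. {t \<in> slice s. order3 t}"
  have "2 \<le> card (?T s)" if s: "s \<in> ?I" for s
  proof -
    obtain t where t: "t \<in> slice s" "order3 t" using s by blast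
    then have "{t, t * t} \<subseteq> ?T s"
      using order3_square subgroup_A5D(2)[OF subgroup_slice] s by auto
    then have "card {t, t * t} \<le> card (?T s)"
      by (intro card_mono) simp_all
    then show ?thesis
      using order3_square[OF t(2)] by auto
  qed
  then have "(\<Sum>s\<in>?I. 2) \<le> (\<Sum>s\<in>?I. card (?T s))"
    by (rule sum_mono)
  also have "\<dots> = card (\<Union>s\<in>?I. ?T s)"
    using slices_disjoint by (intro card_UN_disjoint[symmetric]) auto
  also have "\<dots> \<le> card {t. order3 t}"
    by (intro card_mono) auto
  finally have "card ?I \<le> 10"
    by (simp add: card_order3)
  then show ?thesis
    using False order5_slice_eq_UNIV
    by (intro sum_charge_le[of ?I 5]) (auto simp: charge_def)
qed

end

lemma sum_charge_le_proper:
  assumes "H \<noteq> carrier (wreath_C2 A5)"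
  shows "(\<Sum>s\<in>UNIV. charge s) \<le> 60"
proof (cases "first_projection = UNIV \<and> swaps \<noteq> {}")
  case True
  then show ?thesis using sum_charge_le_projection_full assms by blast
next
  case False
  then show ?thesis
    using sum_charge_le_projection_proper by (cases "swaps = {}") (auto simp: charge_def)
qed

end

section \<open>The lower bound\<close>

lemma subset_triple:
  assumes "finite A" "card A \<le> 3"
  obtains i j k where "A \<subseteq> {i, j, k :: point}"
proof -
  consider "card A = 0" | "card A = 1" | "card A = 2" | "card A = 3"
    using assms(2) by linarith
  then show thesis
  proof cases
    case 1 then show ?thesis using assms(1) that by simp
  next
    case 2 then show ?thesis using that by (metis card_1_singletonE insertI1 empty_subsetI insert_subset)
  next
    case 3 then show ?thesis using that[of _ _ undefined] by (auto simp: card_2_iff)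
  next
    case 4 then show ?thesis using that by (auto simp: card_3_iff)
  qed
qed

text \<open>The elements of order 3 in each \<open>k J\<close> share a fixed point, and some 3-cycle
  moves any three given points. The family is indexed because different members of a cover may have
  equal slices.\<close>

lemma four_le_card_order3_cover:
  assumes fin: "finite F" and F: "\<And>J. J \<in> F \<Longrightarrow> subgroup (k J) A5 \<and> k J \<noteq> UNIV"
    and cover: "\<And>t. order3 t \<Longrightarrow> \<exists>J\<in>F. t \<in> k J"
  shows "4 \<le> card F"
proof (rule ccontr)
  assume "\<not> 4 \<le> card F"
  obtain i where i: "\<And>J t. J \<in> F \<Longrightarrow> t \<in> k J \<Longrightarrow> order3 t \<Longrightarrow> act t (i J) = i J"
  proof -
    have "\<forall>J. \<exists>i. J \<in> F \<longrightarrow> (\<forall>t\<in>k J. order3 t \<longrightarrow> act t i = i)"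
      using order3_common_fixed_point F by meson
    then show thesis
      using that by metis
  qed
  have "card (i ` F) \<le> 3"
    using card_image_le[OF fin, of i] \<open>\<not> 4 \<le> card F\<close> by linarith
  then obtain p q r where "i ` F \<subseteq> {p, q, r}"
    using subset_triple fin by (metis finite_imageI)
  moreover obtain t where "order3 t" "act t p \<noteq> p" "act t q \<noteq> q" "act t r \<noteq> r"
    using ex_order3_moving by blast
  ultimately show False
    using cover[of t] i by fastforce
qed

text \<open>A proper subgroup containing \<open>c\<close> of order 5 normalizes the group generated
  by \<open>c\<close>, so it meets only one of the six Sylow 5-subgroups nontrivially.\<close>

lemma six_le_card_order5_cover:
  assumes fin: "finite F" and F: "\<And>J. J \<in> F \<Longrightarrow> subgroup (k J) A5 \<and> k J \<noteq> UNIV"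
    and cover: "\<And>t. order5 t \<Longrightarrow> \<exists>J\<in>F. t \<in> k J"
  shows "6 \<le> card F"
proof -
  let ?R = "{c. order5 c \<and> act c P1 = P2}"
  obtain f where f: "\<And>c. order5 c \<Longrightarrow> f c \<in> F \<and> c \<in> k (f c)"
    using cover by metis
  have "inj_on f ?R"
  proof (rule inj_onI)
    fix c d assume cd: "c \<in> ?R" "d \<in> ?R" "f c = f d"
    then have "normalizes5 d c"
      using subgroup_order5_eq_UNIV[of "k (f c)" c d] f F by fastforce
    then have "d \<in> {c, c * c, c * (c * c), c * (c * (c * c))}"
      using order5_normalizes5 cd by blast
    then show "c = d"
      using sylow5_representative_unique cd by auto
  qed
  then have "card ?R \<le> card F"
    using f fin by (intro card_inj_on_le[of f]) auto
  then show ?thesis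
    by (simp add: card_sylow5_representatives)
qed

lemma wreath_subgroup_cover_slice:
  assumes cover: "is_subgroup_cover (wreath_C2 A5) C" and t: "order3 t \<or> order5 t"
  obtains H where "H \<in> C" "t \<in> wreath_subgroup.slice H s" "s \<in> wreath_subgroup.swaps H"
proof -
  have "((t * inverse s, s * t), 1) \<in> \<Union>C"
    using cover by (simp add: is_subgroup_cover_def carrier_wreath_C2)
  then obtain H where H: "H \<in> C" "((t * inverse s, s * t), 1) \<in> H" by blast
  then interpret wreath_subgroup H
    using cover by (simp add: is_subgroup_cover_def wreath_subgroup_def)
  have "t \<in> slice s"
    using H(2) by (simp add: slice_def)
  then show thesis
    using that H(1) slice_imp_swaps t by blast
qed

lemma sum_charge_ge:
  assumes fin: "finite C" and cover: "is_subgroup_cover (wreath_C2 A5) C"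
  shows "56 \<le> (\<Sum>H\<in>C. wreath_subgroup.charge H s)"
proof -
  let ?slice = "\<lambda>H. wreath_subgroup.slice H s"
  let ?swap = "\<lambda>H. s \<in> wreath_subgroup.swaps H"
  let ?charge = "\<lambda>H. wreath_subgroup.charge H s"
  have wreath: "wreath_subgroup H" if "H \<in> C" for H
    using cover that by (simp add: is_subgroup_cover_def wreath_subgroup_def)
  show ?thesis
  proof (cases "\<exists>H\<in>C. ?swap H \<and> ?slice H = UNIV")
    case True
    then obtain H where "H \<in> C" "?swap H" "?slice H = UNIV" by blast
    then show ?thesis
      using member_le_sum[of H C ?charge] fin by (simp add: wreath_subgroup.charge_def[OF wreath])
  next
    case False
    let ?F3 = "{H \<in> C. ?swap H \<and> (\<exists>t\<in>?slice H. order3 t)}"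
    let ?F5 = "{H \<in> C. ?swap H \<and> (\<exists>t\<in>?slice H. order5 t)}"
    have proper: "subgroup (?slice H) A5 \<and> ?slice H \<noteq> UNIV" if "H \<in> C" "?swap H" for H
      using False wreath_subgroup.subgroup_slice[OF wreath] that by blast
    have 3: "4 \<le> card ?F3"
    proof (rule four_le_card_order3_cover)
      show "\<exists>J\<in>?F3. t \<in> ?slice J" if "order3 t" for t
        using wreath_subgroup_cover_slice[OF cover, of t s thesis for thesis] that by blast
    qed (use fin proper in auto)
    have 5: "6 \<le> card ?F5"
    proof (rule six_le_card_order5_cover)
      show "\<exists>J\<in>?F5. t \<in> ?slice J" if "order5 t" for t
        using wreath_subgroup_cover_slice[OF cover, of t s thesis for thesis] that by blast
    qed (use fin proper in auto)
    have disj: "?F3 \<inter> ?F5 = {}"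
      using proper subgroup_order3_order5_eq_UNIV by blast
    have "56 \<le> card ?F3 * 5 + card ?F5 * 6"
      using 3 5 by linarith
    also have "card ?F3 * 5 \<le> (\<Sum>H\<in>?F3. ?charge H)"
      using sum_bounded_below[of ?F3 5 ?charge]
      by (auto simp: wreath_subgroup.charge_def[OF wreath])
    also have "card ?F5 * 6 \<le> (\<Sum>H\<in>?F5. ?charge H)"
      using sum_bounded_below[of ?F5 6 ?charge]
      by (auto simp: wreath_subgroup.charge_def[OF wreath])
    also have "(\<Sum>H\<in>?F3. ?charge H) + (\<Sum>H\<in>?F5. ?charge H) = (\<Sum>H\<in>?F3 \<union> ?F5. ?charge H)"
      using fin disj by (intro sum.union_disjoint[symmetric]) auto
    also have "\<dots> \<le> (\<Sum>H\<in>C. ?charge H)"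
      using fin by (intro sum_mono2) auto
    finally show ?thesis by simp
  qed
qed

lemma order3_conj: "order3 t \<Longrightarrow> order3 (x * (t * inverse x))"
  unfolding order3_iff
  by (simp add: mult.assoc) (metis a5_cancel(1) a5_right_inverse mult.assoc mult_1 mult_1_right)

text \<open>An involution outside the base group would conjugate \<open>t\<close> into the first
  projection, making it full. The fifth power of \<open>(c, t)\<close> is then a nontrivial kernel
  element, contradicting \<open>eq_carrier\<close>.\<close>

lemma (in wreath_subgroup) swaps_empty:
  assumes proper: "H \<noteq> carrier (wreath_C2 A5)"
    and x: "((c, t), 0) \<in> H" "order5 c" "order3 t"
  shows "swaps = {}"
proof (rule ccontr)
  assume "swaps \<noteq> {}"
  then obtain r where r: "((inverse r, r), 1) \<in> H" by (auto simp: swaps_def)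
  have "inverse r * (t * inverse (inverse r)) \<in> first_projection" "c \<in> first_projection"
    using conj1[OF r x(1)] x(1) by (auto simp: first_projection_def)
  then have P: "first_projection = UNIV"
    using subgroup_order3_order5_eq_UNIV[OF subgroup_first_projection _ x(2)] order3_conj[OF x(3)]
    by blast
  have "((c * (c * (c * (c * c))), t * (t * (t * (t * t)))), 0) \<in> H"
    using mult00 x(1) by simp
  moreover have "t * (t * (t * (t * t))) \<noteq> 1"
    using x(3) unfolding order3_iff by (metis mult.assoc mult_1 mult_1_right)
  ultimately show False
    using eq_carrier[OF r P] proper x(2) by (auto simp: order5_iff)
qed

lemma card_wreath_cover_ge:
  assumes fin: "finite C" and cover: "is_subgroup_cover (wreath_C2 A5) C"
  shows "57 \<le> card C"
proof -
  have wreath: "wreath_subgroup H" if "H \<in> C" for H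
    using cover that by (simp add: is_subgroup_cover_def wreath_subgroup_def)
  have proper: "H \<noteq> carrier (wreath_C2 A5)" if "H \<in> C" for H
    using cover that by (simp add: is_subgroup_cover_def)
  obtain c where c: "order5 c" using ex_order5 by blast
  obtain t where t: "order3 t" using ex_order3_moving by blast
  have "((c, t), 0) \<in> \<Union>C"
    using cover by (simp add: is_subgroup_cover_def carrier_wreath_C2)
  then obtain B where B: "B \<in> C" "((c, t), 0) \<in> B" by blast
  have zero: "wreath_subgroup.charge B s = 0" for s
    using wreath_subgroup.swaps_empty[OF wreath proper B(2) c t] B(1)
    by (simp add: wreath_subgroup.charge_def[OF wreath])
  \<comment> \<open>Double counting over the 60 values of \<open>s\<close>; removing the uncharged
    \<open>B\<close> gains the final unit.\<close>
  have "60 * 56 = (\<Sum>s\<in>(UNIV :: a5 set). 56 :: nat)"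
    by (simp add: card_UNIV_a5)
  also have "\<dots> \<le> (\<Sum>s\<in>UNIV. \<Sum>H\<in>C. wreath_subgroup.charge H s)"
    by (intro sum_mono sum_charge_ge fin cover)
  also have "\<dots> = (\<Sum>H\<in>C. \<Sum>s\<in>UNIV. wreath_subgroup.charge H s)"
    by (rule sum.swap)
  also have "\<dots> = (\<Sum>H\<in>C - {B}. \<Sum>s\<in>UNIV. wreath_subgroup.charge H s)"
    using fin zero by (intro sum.mono_neutral_right) auto
  also have "\<dots> \<le> (\<Sum>H\<in>C - {B}. 60)"
    using wreath_subgroup.sum_charge_le_proper[OF wreath proper] by (intro sum_mono) auto
  also have "\<dots> = 60 * (card C - 1)"
    using B(1) fin by simp
  finally show ?thesis by linarith
qed

section \<open>The upper bound\<close>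

text \<open>For an action \<open>f\<close>, this is the stabilizer of \<open>(p, q)\<close> in the
  product action, where the swapping generator exchanges the coordinates.\<close>

definition stabilizer_pair :: "(a5 \<Rightarrow> 'x \<Rightarrow> 'x) \<Rightarrow> 'x \<Rightarrow> 'x \<Rightarrow> ((a5 \<times> a5) \<times> int) set" where
  "stabilizer_pair f p q =
    {((a, b), 0) | a b. f a p = p \<and> f b q = q} \<union> {((a, b), 1) | a b. f a q = p \<and> f b p = q}"

lemma subgroup_stabilizer_pair:
  assumes one: "\<And>p. f 1 p = p" and mult: "\<And>a b p. f (a * b) p = f a (f b p)"
  shows "subgroup (stabilizer_pair f p q) (wreath_C2 A5)"
proof -
  interpret W: group "wreath_C2 A5"
    by (rule group_wreath_C2_A5)
  have inverse: "f (inverse a) p = q" if "f a q = p" for a p q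
    using that mult[of "inverse a" a] one by auto
  show ?thesis
  proof (rule W.subgroupI)
    show "stabilizer_pair f p q \<subseteq> carrier (wreath_C2 A5)"
      by (auto simp: stabilizer_pair_def carrier_wreath_C2)
    show "stabilizer_pair f p q \<noteq> {}"
      using one by (auto simp: stabilizer_pair_def)
    show "x \<otimes>\<^bsub>wreath_C2 A5\<^esub> y \<in> stabilizer_pair f p q"
      if "x \<in> stabilizer_pair f p q" "y \<in> stabilizer_pair f p q" for x y
      using that by (auto simp: stabilizer_pair_def mult_wreath_C2 mult)
    show "inv\<^bsub>wreath_C2 A5\<^esub> x \<in> stabilizer_pair f p q" if "x \<in> stabilizer_pair f p q" for x
      using that by (auto simp: stabilizer_pair_def inv_wreath_C2_A5 intro: inverse)
  qed
qed

lemma stabilizer_pair_proper: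
  assumes "f 1 q = q" "f a p \<noteq> p"
  shows "stabilizer_pair f p q \<noteq> carrier (wreath_C2 A5)"
proof -
  have "((a, 1), 0) \<notin> stabilizer_pair f p q"
    using assms by (auto simp: stabilizer_pair_def)
  then show ?thesis
    by (auto simp: carrier_wreath_C2)
qed

section \<open>Conjugation action on the Sylow 5-subgroups\<close>

definition powers5 :: "a5 \<Rightarrow> a5 set" where
  "powers5 c = {c, c * c, c * (c * c), c * (c * (c * c))}"

definition conj_act :: "a5 \<Rightarrow> a5 set \<Rightarrow> a5 set" where
  "conj_act x S = (\<lambda>c. x * (c * inverse x)) ` S"

lemma conj_act_one: "conj_act 1 S = S"
  by (simp add: conj_act_def)

lemma conj_act_mult: "conj_act (x * y) S = conj_act x (conj_act y S)"
  by (simp add: conj_act_def image_image mult.assoc)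

lemma conj_act_powers5: "conj_act x (powers5 c) = powers5 (x * (c * inverse x))"
  by (simp add: conj_act_def powers5_def mult.assoc)

lemma order5_conj: "order5 c \<Longrightarrow> order5 (x * (c * inverse x))"
  unfolding order5_iff
  by (simp add: mult.assoc) (metis a5_cancel(1) a5_right_inverse mult.assoc mult_1 mult_1_right)

lemma order5_cancel: "order5 c \<Longrightarrow> c * (c * (c * (c * (c * x)))) = x"
  unfolding order5_iff by (metis mult.assoc mult_1)

lemma powers5_eq:
  assumes "order5 c" "d \<in> powers5 c"
  shows "powers5 d = powers5 c"
  using assms(2) assms(1)[unfolded order5_iff] order5_cancel[OF assms(1)]
  by (auto simp: powers5_def mult.assoc)

text \<open>A Sylow 5-subgroup is represented by the set of its nontrivial elements.\<close>

definition sylow5 :: "a5 set set" where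
  "sylow5 = powers5 ` {c. order5 c \<and> act c P1 = P2}"

lemma card_sylow5: "card sylow5 \<le> 6"
  unfolding sylow5_def using card_image_le[of "{c. order5 c \<and> act c P1 = P2}" powers5]
  by (simp add: card_sylow5_representatives)

lemma finite_sylow5: "finite sylow5"
  by (simp add: sylow5_def)

lemma powers5_in_sylow5:
  assumes "order5 c"
  shows "powers5 c \<in> sylow5"
proof -
  obtain d where "order5 d" "act d P1 = P2" "d \<in> powers5 c"
    using sylow5_representative assms unfolding powers5_def by blast
  then show ?thesis
    using powers5_eq[OF assms] unfolding sylow5_def by blast
qed

lemma normalizes5_conj_act:
  assumes "order5 c" "normalizes5 x c"
  shows "conj_act x (powers5 c) = powers5 c"
proof -
  have "x * (c * inverse x) \<in> powers5 c"
    using assms(2) by (auto simp: normalizes5_iff powers5_def a5_conj_eq_iff mult.assoc)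
  then show ?thesis
    using powers5_eq[OF assms(1)] by (simp add: conj_act_powers5)
qed

lemma sylow5_moved:
  assumes "S \<in> sylow5"
  shows "\<exists>x. conj_act x S \<noteq> S"
proof -
  obtain c where c: "order5 c" "S = powers5 c"
    using assms by (auto simp: sylow5_def)
  obtain x where x: "x * c \<notin> {c * x, c * (c * x), c * (c * (c * x)), c * (c * (c * (c * x)))}"
    using ex_conj_not_power5 c(1) by blast
  then have "x * (c * inverse x) \<notin> powers5 c"
    by (simp add: powers5_def a5_conj_eq_iff mult.assoc)
  moreover have "x * (c * inverse x) \<in> conj_act x S"
    by (simp add: c conj_act_def powers5_def)
  ultimately show ?thesis
    using c by blast
qed

lemma act_moves: "\<exists>t. act t i \<noteq> i"
  using ex_order3_moving by blast

definition wreath_cover :: "((a5 \<times> a5) \<times> int) set set" where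
  "wreath_cover = {UNIV \<times> {0}}
    \<union> case_prod (stabilizer_pair act) ` ({P1, P2, P3, P4} \<times> {P1, P2, P3, P4, P5})
    \<union> case_prod (stabilizer_pair conj_act) ` (sylow5 \<times> sylow5)"

lemma stabilizer_pair_act_in_wreath_cover:
  assumes "i \<noteq> P5"
  shows "stabilizer_pair act i j \<in> wreath_cover"
proof -
  have "(i, j) \<in> {P1, P2, P3, P4} \<times> {P1, P2, P3, P4, P5}"
    using assms by (cases i; cases j) simp_all
  then have "case_prod (stabilizer_pair act) (i, j) \<in> wreath_cover"
    unfolding wreath_cover_def by (intro UnI1 UnI2 imageI)
  then show ?thesis by simp
qed

lemma stabilizer_pair_conj_act_in_wreath_cover:
  assumes "S \<in> sylow5" "T \<in> sylow5"
  shows "stabilizer_pair conj_act S T \<in> wreath_cover"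
proof -
  have "case_prod (stabilizer_pair conj_act) (S, T) \<in> wreath_cover"
    unfolding wreath_cover_def using assms by (intro UnI2 imageI) simp
  then show ?thesis by simp
qed

lemma finite_wreath_cover: "finite wreath_cover"
  by (simp add: wreath_cover_def finite_sylow5)

lemma card_wreath_cover_le: "card wreath_cover \<le> 57"
proof -
  let ?A = "{P1, P2, P3, P4} \<times> {P1, P2, P3, P4, P5}"
  let ?S = "case_prod (stabilizer_pair act) ` ?A"
  let ?T = "case_prod (stabilizer_pair conj_act) ` (sylow5 \<times> sylow5)"
  have "card wreath_cover \<le> card ({UNIV \<times> {0 :: int}} \<union> ?S) + card ?T"
    unfolding wreath_cover_def by (rule card_Un_le)
  also have "card ({UNIV \<times> {0 :: int}} \<union> ?S) \<le> 1 + card ?S"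
    using card_Un_le[of "{UNIV \<times> {0 :: int}}" ?S] by simp
  also have "card ?S \<le> card ?A"
    by (rule card_image_le) simp
  also have "card ?T \<le> card (sylow5 \<times> sylow5)"
    by (rule card_image_le) (simp add: finite_sylow5)
  also have "card ?A = 20"
    by (simp add: card_cartesian_product)
  also have "card (sylow5 \<times> sylow5) \<le> 6 * 6"
    unfolding card_cartesian_product by (intro mult_le_mono card_sylow5)
  finally show ?thesis by simp
qed

lemma base_subgroup: "subgroup (UNIV \<times> {0}) (wreath_C2 A5)"
  by (rule group.subgroupI[OF group_wreath_C2_A5])
    (auto simp: carrier_wreath_C2 mult_wreath_C2 inv_wreath_C2_A5)

lemma is_subgroup_cover_wreath_cover: "is_subgroup_cover (wreath_C2 A5) wreath_cover"
proof -
  \<comment> \<open>The element \<open>((a, b), 1)\<close> fixes a pair \<open>(p, q)\<close>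
    exactly when \<open>q\<close> is the image of \<open>p\<close> under \<open>b\<close> and
    \<open>a * b\<close> fixes \<open>p\<close>, so only the product \<open>a * b\<close>
    matters.\<close>
  have outside: "((a, b), 1) \<in> \<Union>wreath_cover" for a b
    using normalizes5_or_fixes_point[rule_format, of "a * b"]
  proof
    assume "\<exists>c. order5 c \<and> normalizes5 (a * b) c"
    then obtain c where c: "order5 c" "normalizes5 (a * b) c" by blast
    have "conj_act b (powers5 c) \<in> sylow5"
      unfolding conj_act_powers5 by (intro powers5_in_sylow5 order5_conj c)
    moreover have "((a, b), 1) \<in> stabilizer_pair conj_act (powers5 c) (conj_act b (powers5 c))"
      using normalizes5_conj_act[OF c] by (simp add: stabilizer_pair_def conj_act_mult)
    ultimately show ?thesis
      using stabilizer_pair_conj_act_in_wreath_cover powers5_in_sylow5[OF c(1)] by blast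
  next
    assume "\<exists>i. i \<noteq> P5 \<and> act (a * b) i = i"
    then obtain i where i: "i \<noteq> P5" "act (a * b) i = i" by blast
    have "((a, b), 1) \<in> stabilizer_pair act i (act b i)"
      using i(2) by (simp add: stabilizer_pair_def act_mult)
    then show ?thesis
      using stabilizer_pair_act_in_wreath_cover[OF i(1)] by blast
  qed
  have proper: "subgroup H (wreath_C2 A5) \<and> H \<noteq> carrier (wreath_C2 A5)" if "H \<in> wreath_cover" for H
    using that unfolding wreath_cover_def
  proof (elim UnE imageE)
    fix x assume "x \<in> sylow5 \<times> sylow5" "H = case_prod (stabilizer_pair conj_act) x"
    then obtain S T where "H = stabilizer_pair conj_act S T" "S \<in> sylow5"
      by auto
    moreover then obtain y where "conj_act y S \<noteq> S"
      using sylow5_moved by blast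
    ultimately show ?thesis
      using subgroup_stabilizer_pair[of conj_act S T, OF conj_act_one conj_act_mult]
        stabilizer_pair_proper[of conj_act T y S, OF conj_act_one] by blast
  next
    fix x :: "point \<times> point" assume "H = case_prod (stabilizer_pair act) x"
    then obtain i j where "H = stabilizer_pair act i j"
      by (cases x) auto
    moreover obtain t where "act t i \<noteq> i"
      using act_moves by blast
    ultimately show ?thesis
      using subgroup_stabilizer_pair[of act i j, OF act_one act_mult]
        stabilizer_pair_proper[of act j t i, OF act_one] by blast
  next
    assume "H \<in> {UNIV \<times> {0}}"
    then show ?thesis
      using base_subgroup by (auto simp: carrier_wreath_C2 times_eq_iff)
  qed
  have "((a, b), 0) \<in> \<Union>wreath_cover" for a b
    by (auto simp: wreath_cover_def)
  then have "carrier (wreath_C2 A5) \<subseteq> \<Union>wreath_cover"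
    using outside unfolding carrier_wreath_C2 by (intro subsetI) (elim SigmaE insertE emptyE; simp only:)
  moreover have "\<Union>wreath_cover \<subseteq> carrier (wreath_C2 A5)"
    by (intro Union_least subgroup.subset) (simp add: proper)
  ultimately show ?thesis
    using proper by (auto simp: is_subgroup_cover_def)
qed

lemma covering_number_wreath_C2_A5: "covering_number (wreath_C2 A5) = 57"
  unfolding covering_number_def
proof (rule Least_equality)
  \<comment> \<open>The listed members are counted only from above; the lower bound, applied to this
    cover, shows that none coincide.\<close>
  have "card wreath_cover = 57"
    using card_wreath_cover_le card_wreath_cover_ge[OF finite_wreath_cover is_subgroup_cover_wreath_cover]
    by linarith
  then show "\<exists>C. finite C \<and> card C = 57 \<and> is_subgroup_cover (wreath_C2 A5) C"
    using finite_wreath_cover is_subgroup_cover_wreath_cover by blast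
qed (use card_wreath_cover_ge in blast)

section \<open>Transfer to the alternating group on natural numbers\<close>

lemma subgroup_cover_iso:
  assumes groups: "group G" "group K" and h: "h \<in> iso G K" and C: "is_subgroup_cover G C"
  shows "is_subgroup_cover K ((`) h ` C) \<and> card ((`) h ` C) = card C"
proof -
  interpret group_hom G K h
    using groups h by (simp add: group_hom_def group_hom_axioms_def iso_def)
  have bij: "bij_betw h (carrier G) (carrier K)"
    using h by (simp add: iso_def)
  have C_sub: "H \<subseteq> carrier G" if "H \<in> C" for H
    using C that by (simp add: is_subgroup_cover_def subgroup.subset)
  have inj: "inj_on ((`) h) (Pow (carrier G))"
    using bij by (simp add: bij_betw_def inj_on_image_Pow)
  have "h ` H \<noteq> carrier K" if "H \<in> C" for H
    using C that C_sub[OF that] bij inj_onD[OF inj, of H "carrier G"]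
    by (auto simp: is_subgroup_cover_def bij_betw_def)
  then have "is_subgroup_cover K ((`) h ` C)"
    using C bij subgroup_img_is_subgroup
    by (auto simp: is_subgroup_cover_def bij_betw_def simp flip: image_Union)
  moreover have "card ((`) h ` C) = card C"
    using C_sub by (intro card_image inj_on_subset[OF inj]) blast
  ultimately show ?thesis ..
qed

lemma covering_number_iso:
  assumes groups: "group G" "group K" and h: "h \<in> iso G K"
  shows "covering_number G = covering_number K"
proof -
  have g: "inv_into (carrier G) h \<in> iso K G"
    using group.iso_set_sym[OF groups(1) h] .
  have "(\<exists>C. finite C \<and> card C = n \<and> is_subgroup_cover G C) \<longleftrightarrow>
      (\<exists>C. finite C \<and> card C = n \<and> is_subgroup_cover K C)" for n
    using subgroup_cover_iso[OF groups h] subgroup_cover_iso[OF groups(2,1) g] by (metis finite_imageI)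
  then show ?thesis
    by (simp add: covering_number_def)
qed

lemma wreath_C2_iso:
  assumes "h \<in> iso G K"
  shows "(\<lambda>((a, b), k). ((h a, h b), k)) \<in> iso (wreath_C2 G) (wreath_C2 K)"
proof -
  have "map_prod (map_prod h h) id \<in> iso (wreath_C2 G) (wreath_C2 K)"
    unfolding iso_def mem_Collect_eq
  proof
    show "map_prod (map_prod h h) id \<in> hom (wreath_C2 G) (wreath_C2 K)"
      using assms by (auto simp: iso_def hom_def carrier_wreath_C2 mult_wreath_C2)
    show "bij_betw (map_prod (map_prod h h) id) (carrier (wreath_C2 G)) (carrier (wreath_C2 K))"
      unfolding carrier_wreath_C2 using assms
      by (intro bij_betw_map_prod) (simp_all add: iso_def)
  qed
  moreover have "map_prod (map_prod h h) id = (\<lambda>((a, b), k). ((h a, h b), k))"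
    by auto
  ultimately show ?thesis by metis
qed

fun point_to_nat :: "point \<Rightarrow> nat" where
  "point_to_nat P1 = 1" | "point_to_nat P2 = 2" | "point_to_nat P3 = 3"
| "point_to_nat P4 = 4" | "point_to_nat P5 = 5"

text \<open>The subtraction matches the points 1 to 5 with list positions 0 to 4;
  \<open>to_fun\<close> guards against other arguments.\<close>

definition nat_to_point :: "nat \<Rightarrow> point" where
  "nat_to_point n = [P1, P2, P3, P4, P5] ! (n - 1)"

definition to_fun :: "a5 \<Rightarrow> nat \<Rightarrow> nat" where
  "to_fun x n = (if n \<in> {1..5} then point_to_nat (act x (nat_to_point n)) else n)"

lemma nat_to_point_to_nat [simp]: "nat_to_point (point_to_nat i) = i"
  by (cases i) (simp_all add: nat_to_point_def)

lemma point_to_nat_range: "point_to_nat i \<in> {1..5}"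
  by (cases i) simp_all

lemma to_fun_point [simp]: "to_fun x (point_to_nat i) = point_to_nat (act x i)"
  using point_to_nat_range[of i] by (simp add: to_fun_def)

lemma to_fun_outside: "n \<notin> {1..5} \<Longrightarrow> to_fun x n = n"
  by (simp only: to_fun_def if_False)

lemma nat_point_cases:
  obtains i where "n = point_to_nat i" | "n \<notin> {1..5}"
proof (cases "n \<in> {1..5}")
  case True
  then have "n \<in> {1, 2, 3, 4, 5}" by auto
  then show thesis
    using that(1)[of P1] that(1)[of P2] that(1)[of P3] that(1)[of P4] that(1)[of P5] by auto
qed (use that in blast)

lemma to_fun_one: "to_fun 1 = id"
proof
  show "to_fun 1 n = id n" for n
    by (cases n rule: nat_point_cases) (simp_all add: act_one to_fun_outside del: atLeastAtMost_iff)
qed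

lemma to_fun_mult: "to_fun (x * y) = to_fun x \<circ> to_fun y"
proof
  show "to_fun (x * y) n = (to_fun x \<circ> to_fun y) n" for n
    by (cases n rule: nat_point_cases) (simp_all add: act_mult to_fun_outside del: atLeastAtMost_iff)
qed

lemma act_inject: "act x = act y \<Longrightarrow> x = y"
proof -
  have "app5 p = app5 q \<Longrightarrow> p = q" for p q
  proof -
    assume "app5 p = app5 q"
    then have "app5 p i = app5 q i" for i by simp
    from this[of P1] this[of P2] this[of P3] this[of P4] this[of P5] show ?thesis
      by (cases p; cases q) simp
  qed
  then show "act x = act y \<Longrightarrow> x = y" by transfer
qed

lemma inj_to_fun: "inj to_fun"
proof (rule injI, rule act_inject, rule ext)
  fix x y i assume "to_fun x = to_fun y"
  then have "to_fun x (point_to_nat i) = to_fun y (point_to_nat i)" by simp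
  then have "point_to_nat (act x i) = point_to_nat (act y i)"
    by simp
  then show "act x i = act y i"
    by (metis nat_to_point_to_nat)
qed

lemma to_fun_permutes: "to_fun x permutes {1..5}"
proof (rule bij_imp_permutes)
  have image: "to_fun y ` {1..5} \<subseteq> {1..5}" for y
  proof
    show "m \<in> {1..5}" if "m \<in> to_fun y ` {1..5}" for m
    proof -
      obtain n where "m = to_fun y n" "n \<in> {1..5}" using \<open>m \<in> _\<close> by blast
      then show ?thesis
        using point_to_nat_range by (cases n rule: nat_point_cases) auto
    qed
  qed
  have "to_fun y (to_fun (inverse y) n) = n" for y n
    using to_fun_mult[of y "inverse y"] by (simp add: to_fun_one fun_eq_iff)
  from this this[of "inverse x"] show "bij_betw (to_fun x) {1..5} {1..5}"
    using image by (intro bij_betw_byWitness[where f' = "to_fun (inverse x)"]) auto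
qed (rule to_fun_outside)

text \<open>Every element is a product of two squares and squares of permutations are even, so the
  inversion count in \<open>even5\<close> need not be compared with \<open>evenperm\<close>.\<close>

lemma evenperm_to_fun: "evenperm (to_fun x)"
proof -
  obtain y z where x: "x = y * (y * (z * z))"
    using product_of_squares by blast
  have "permutation (to_fun w)" for w
    using to_fun_permutes by (auto simp: permutation_permutes)
  then show ?thesis
    unfolding x to_fun_mult by (simp add: evenperm_comp permutation_compose)
qed

text \<open>Surjectivity comes from injectivity, since both groups have 60 elements.\<close>

lemma to_fun_iso: "to_fun \<in> iso A5 (alt_group 5)"
proof -
  have sub: "range to_fun \<subseteq> carrier (alt_group 5)"
    using to_fun_permutes evenperm_to_fun by (auto simp: alt_group_carrier)
  have card: "card (carrier (alt_group 5)) = 60"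
    using alt_group_card_carrier[of 5] by (simp add: fact_numeral)
  then have "finite (carrier (alt_group 5))"
    by (metis card.infinite zero_neq_numeral)
  then have "range to_fun = carrier (alt_group 5)"
    using sub by (rule card_subset_eq) (simp add: card card_image inj_to_fun card_UNIV_a5)
  then show ?thesis
    using inj_to_fun to_fun_mult by (auto simp: iso_def hom_def bij_betw_def alt_group_mult)
qed

theorem theorem2:
  shows "covering_number (wreath_C2 (alt_group 5)) = 1 + 4 * 5 + 6 * 6 \<and>
    1 + 4 * 5 + 6 * 6 = (57 :: nat)"
proof -
  have "covering_number (wreath_C2 A5) = covering_number (wreath_C2 (alt_group 5))"
    by (intro covering_number_iso[OF _ _ wreath_C2_iso[OF to_fun_iso]] group_wreath_C2
        A5.group_axioms alt_group_is_group)
  then show ?thesis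
    by (simp add: covering_number_wreath_C2_A5)
qed

end
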